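(* Let $\rho$ be a law-invariant coherent risk measure, $\Xi\subseteq\mathbb{R}^m$ convex, $\|\cdot\|$ a norm on $\mathbb{R}^m$, and let $d_\rho:\mathcal M(\Xi)\times\mathcal M(\Xi)\to\mathbb{R}_+$ be the coherent Wasserstein metric $$d_\rho(\mathbb P_1,\mathbb P_2)=\inf\big\{\rho^{\Pi}(\|\xi_1-\xi_2\|):\ \Pi\text{ is a joint distribution of }\xi_1,\xi_2\text{ with marginals }\mathbb P_1,\mathbb P_2\big\}.$$ Then: (i) (identity of indiscernibles) $d_\rho(\mathbb P_1,\mathbb P_2)=0$ if and only if $\mathbb P_1=\mathbb P_2$; (ii) (symmetry) $d_\rho(\mathbb P_1,\mathbb P_2)=d_\rho(\mathbb P_2,\mathbb P_1)$ for any $\mathbb P_1,\mathbb P_2$; (iii) (triangle inequality) $d_\rho(\mathbb P_1,\mathbb P_2)+d_\rho(\mathbb P_2,\mathbb P_3)\ge d_\rho(\mathbb P_1,\mathbb P_3)$ for any $\mathbb P_1,\mathbb P_2,\mathbb P_3$; (iv) (non-negativity) $d_\rho(\mathbb P_1,\mathbb P_2)\ge0$ for any $\mathbb P_1,\mathbb P_2$.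
   Context: $\mathcal M(\Xi)$ is the set of probability distributions supported on $\Xi$. A law-invariant coherent risk measure $\rho$ is a functional on nonnegative random variables on an atomless probability space satisfying $\rho(0)=0$ and: translation invariance $\rho(X+c)=\rho(X)+c$ for $c\ge0$; monotonicity $\rho(X_1)\ge\rho(X_2)$ whenever $X_1\ge X_2$; subadditivity; positive homogeneity $\rho(cX)=c\rho(X)$ for $c>0$; law invariance ($\rho(X_1)=\rho(X_2)$ if $X_1,X_2$ have the same distribution). $\rho^\Pi(\|\xi_1-\xi_2\|)$ is the value of $\rho$ on the law of $\|\xi_1-\xi_2\|$ when $(\xi_1,\xi_2)\sim\Pi$. The value $+\infty$ is allowed for $\rho$, and hence for $d_\rho$, with the usual conventions. *)

theory Defs
  imports "HOL-Probability.Probability"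
begin

definition atomless :: "'w measure \<Rightarrow> bool" where
  "atomless M \<longleftrightarrow>
     (\<forall>A\<in>sets M. 0 < emeasure M A \<longrightarrow>
        (\<exists>B\<in>sets M. B \<subseteq> A \<and> 0 < emeasure M B \<and> emeasure M B < emeasure M A))"

definition nonneg_rvs :: "'w measure \<Rightarrow> ('w \<Rightarrow> real) set" where
  "nonneg_rvs M = {X \<in> borel_measurable M. \<forall>\<omega>\<in>space M. 0 \<le> X \<omega>}"

text \<open>The order on random variables is pointwise on the sample space. Under law invariance this is
  equivalent to the almost sure order. Values are in \<^typ>\<open>ereal\<close> so that \<open>\<infinity>\<close> is allowed and
  non-negativity is not built into the type; \<open>- \<infinity>\<close> is excluded by monotonicity
  and \<open>\<rho> 0 = 0\<close>. The values of \<open>\<rho>\<close> outside \<^term>\<open>nonneg_rvs \<Omega>\<close> are irrelevant.\<close>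

locale law_invariant_coherent_risk_measure = prob_space \<Omega>
  for \<Omega> :: "'w measure" +
  fixes \<rho> :: "('w \<Rightarrow> real) \<Rightarrow> ereal"
  assumes atomless: "atomless \<Omega>"
    and zero: "\<rho> (\<lambda>_. 0) = 0"
    and translation_invariance:
      "\<And>X c. X \<in> nonneg_rvs \<Omega> \<Longrightarrow> 0 \<le> c \<Longrightarrow> \<rho> (\<lambda>\<omega>. X \<omega> + c) = \<rho> X + ereal c"
    and monotonicity:
      "\<And>X Y. X \<in> nonneg_rvs \<Omega> \<Longrightarrow> Y \<in> nonneg_rvs \<Omega> \<Longrightarrow>
         (\<And>\<omega>. \<omega> \<in> space \<Omega> \<Longrightarrow> Y \<omega> \<le> X \<omega>) \<Longrightarrow> \<rho> Y \<le> \<rho> X"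
    and subadditivity:
      "\<And>X Y. X \<in> nonneg_rvs \<Omega> \<Longrightarrow> Y \<in> nonneg_rvs \<Omega> \<Longrightarrow>
         \<rho> (\<lambda>\<omega>. X \<omega> + Y \<omega>) \<le> \<rho> X + \<rho> Y"
    and positive_homogeneity:
      "\<And>X c. X \<in> nonneg_rvs \<Omega> \<Longrightarrow> 0 < c \<Longrightarrow> \<rho> (\<lambda>\<omega>. c * X \<omega>) = ereal c * \<rho> X"
    and law_invariance:
      "\<And>X Y. X \<in> nonneg_rvs \<Omega> \<Longrightarrow> Y \<in> nonneg_rvs \<Omega> \<Longrightarrow>
         distr \<Omega> borel X = distr \<Omega> borel Y \<Longrightarrow> \<rho> X = \<rho> Y"

text \<open>The value of \<open>\<rho>\<close> on a law \<open>\<mu>\<close> on \<open>[0, \<infinity>)\<close> is its value on any random variable on \<open>\<Omega>\<close>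
  with law \<open>\<mu>\<close>. Such a random variable exists because \<open>\<Omega>\<close> is atomless, and the value is unique
  by law invariance.\<close>

definition risk_of_law :: "'w measure \<Rightarrow> (('w \<Rightarrow> real) \<Rightarrow> ereal) \<Rightarrow> real measure \<Rightarrow> ereal" where
  "risk_of_law \<Omega> \<rho> \<mu> = (THE r. \<exists>X\<in>nonneg_rvs \<Omega>. distr \<Omega> borel X = \<mu> \<and> r = \<rho> X)"

lemma (in law_invariant_coherent_risk_measure) risk_of_law_distr:
  assumes "X \<in> nonneg_rvs \<Omega>"
  shows "risk_of_law \<Omega> \<rho> (distr \<Omega> borel X) = \<rho> X"
  unfolding risk_of_law_def using assms by (intro the_equality) (auto intro: law_invariance)

text \<open>An arbitrary norm on \<open>\<real>\<^sup>m\<close>, not necessarily the Euclidean one.\<close>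

definition is_norm :: "('a::real_vector \<Rightarrow> real) \<Rightarrow> bool" where
  "is_norm N \<longleftrightarrow>
     (\<forall>x. 0 \<le> N x) \<and> (\<forall>x. N x = 0 \<longleftrightarrow> x = 0) \<and>
     (\<forall>c x. N (c *\<^sub>R x) = \<bar>c\<bar> * N x) \<and> (\<forall>x y. N (x + y) \<le> N x + N y)"

text \<open>A convex \<open>\<Xi>\<close> need not be a Borel set, so "supported on \<open>\<Xi>\<close>" is phrased with \<open>AE\<close>.
  For Borel \<open>\<Xi>\<close> it says that \<open>\<Xi>\<close> has probability 1.\<close>

definition distributions_on :: "'a::topological_space set \<Rightarrow> 'a measure set" where
  "distributions_on \<Xi> = {P. prob_space P \<and> sets P = sets borel \<and> (AE \<xi> in P. \<xi> \<in> \<Xi>)}"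

definition couplings ::
    "'a::topological_space measure \<Rightarrow> 'a measure \<Rightarrow> ('a \<times> 'a) measure set" where
  "couplings P1 P2 = {Q. prob_space Q \<and> sets Q = sets (borel \<Otimes>\<^sub>M borel) \<and>
     distr Q borel fst = P1 \<and> distr Q borel snd = P2}"

definition coherent_wasserstein ::
    "'w measure \<Rightarrow> (('w \<Rightarrow> real) \<Rightarrow> ereal) \<Rightarrow> ('a::real_normed_vector \<Rightarrow> real)
      \<Rightarrow> 'a measure \<Rightarrow> 'a measure \<Rightarrow> ereal" where
  "coherent_wasserstein \<Omega> \<rho> N P1 P2 =
     (INF Q\<in>couplings P1 P2.
        risk_of_law \<Omega> \<rho> (distr Q borel (\<lambda>(\<xi>1, \<xi>2). N (\<xi>1 - \<xi>2))))"

end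

theory Submission
  imports Defs
begin

text \<open>
  Non-negativity and symmetry follow from the monotonicity of the risk measure and from swapping
  the two components of a coupling, once each law on \<open>[0, \<infinity>)\<close> is known to be the law of
  some variable on the atomless space \<open>\<Omega>\<close>. Such variables are quantile functions composed with a
  uniform variable, which in turn comes from a maximal chain of events
  (\<open>atomless_increasing_events\<close>, \<open>atomless_realises_laws\<close>). Quantile functions respect
  stochastic order, and so the axioms of \<open>\<rho>\<close> carry over to the induced functional \<open>risk M\<close> on
  non-negative variables over an arbitrary probability space \<open>M\<close> (\<open>risk_mono\<close>,
  \<open>risk_add_const\<close>, \<open>risk_subadditive\<close>). For subadditivity one has to realise a pair of
  variables jointly on \<open>\<Omega>\<close>. It is enough to do this for pairs with values in a grid of small
  mesh, and such a pair is coded by a single natural number.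

  For the triangle inequality, couplings of \<open>P1, P2\<close> and of \<open>P2, P3\<close> would usually be glued
  along \<open>P2\<close> by disintegration. Here they are glued approximately: the space is cut into
  countably many cells of diameter at most \<open>e\<close>, and, conditionally on the cell of the
  \<open>P2\<close>-component, the two couplings are made independent (\<open>glue_along_label\<close>). The two copies
  of the middle point then lie in the same cell, which costs at most \<open>e\<close> by translation
  invariance (\<open>approximate_composition\<close>), and \<open>e\<close> is arbitrary.

  For the identity of indiscernibles, cut \<open>\<Omega>\<close> into \<open>n\<close> events of probability \<open>1/n\<close>. Their
  indicators have equal risk by law invariance and add up to a variable of risk \<open>1\<close>, so each of
  them has risk at least \<open>1/n\<close>. Hence a variable that is at least \<open>e\<close> with probability at least
  \<open>1/n\<close> has risk at least \<open>e/n\<close> (\<open>risk_ge_of_tail\<close>), so a vanishing distance yields couplings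
  under which the two components are close with probability near \<open>1\<close>. This forces
  \<open>P1 F \<le> P2 F\<close> for closed \<open>F\<close> (\<open>wasserstein_zero_closed_le\<close>) and, by symmetry, equality on
  closed sets, which generate the Borel sets.
\<close>

section \<open>Uniform random variables on atomless spaces\<close>

text \<open>A continuum of nested events, one of each probability, is found inside a maximal chain. Ordering
  events by inclusion alone would allow many members of a chain to differ by null sets only, so
  that an event inserted between two of them need not be comparable to all the others.
  Requiring the probability to grow as well makes the probability injective on chains.\<close>

definition (in prob_space) precedes :: "'a set \<Rightarrow> 'a set \<Rightarrow> bool" where
  "precedes A B \<longleftrightarrow> A \<subseteq> B \<and> prob A < prob B"

text \<open>The last conjunct is maximality of the chain, in the form that lets limits and intermediate
  events be recognised as members.\<close>

definition (in prob_space) saturated_chain :: "'a set set \<Rightarrow> bool" where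
  "saturated_chain C \<longleftrightarrow> C \<subseteq> events \<and>
     (\<forall>A\<in>C. \<forall>B\<in>C. A = B \<or> precedes A B \<or> precedes B A) \<and>
     (\<forall>E\<in>events. (\<forall>A\<in>C. A = E \<or> precedes A E \<or> precedes E A) \<longrightarrow> E \<in> C)"

context prob_space
begin

lemma saturated_chain_exists: "\<exists>C. saturated_chain C"
proof -
  obtain C where C: "pred_on.maxchain events precedes C"
    using pred_on.Hausdorff by blast
  then have chain: "pred_on.chain events precedes C"
    unfolding pred_on.maxchain_def by (rule conjunct1)
  have sub: "C \<subseteq> events"
    using chain unfolding pred_on.chain_def by (rule conjunct1)
  have tot: "\<forall>A\<in>C. \<forall>B\<in>C. A = B \<or> precedes A B \<or> precedes B A"
  proof (intro ballI)
    fix A B assume "A \<in> C" "B \<in> C"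
    from pred_on.chain_total[OF chain this] show "A = B \<or> precedes A B \<or> precedes B A"
      by auto
  qed
  have sat: "E \<in> C" if E: "E \<in> events" and cmp: "\<forall>A\<in>C. A = E \<or> precedes A E \<or> precedes E A" for E
  proof (rule ccontr)
    assume "E \<notin> C"
    have "A = B \<or> precedes A B \<or> precedes B A" if "A \<in> insert E C" "B \<in> insert E C" for A B
    proof (cases "A = E \<or> B = E")
      case True
      then show ?thesis
        using that cmp[rule_format, of A] cmp[rule_format, of B] by auto
    next
      case False
      then show ?thesis
        using that tot[rule_format, of A B] by auto
    qed
    then have "pred_on.chain events precedes (insert E C)"
      using sub E by (intro pred_on.chainI) auto
    moreover have "C \<subset> insert E C" using \<open>E \<notin> C\<close> by auto
    ultimately have "\<exists>S. pred_on.chain events precedes S \<and> C \<subset> S" by blast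
    with C show False
      unfolding pred_on.maxchain_def by (elim conjE) (rule notE)
  qed
  show ?thesis
    unfolding saturated_chain_def
  proof (rule exI[of _ C], intro conjI, rule sub, rule tot)
    show "\<forall>E\<in>events. (\<forall>A\<in>C. A = E \<or> precedes A E \<or> precedes E A) \<longrightarrow> E \<in> C"
      using sat by simp
  qed
qed

lemma saturated_chain_events: "saturated_chain C \<Longrightarrow> A \<in> C \<Longrightarrow> A \<in> events"
  unfolding saturated_chain_def by (elim conjE) (rule subsetD)

lemma saturated_chain_total:
  "saturated_chain C \<Longrightarrow> A \<in> C \<Longrightarrow> B \<in> C \<Longrightarrow> A = B \<or> precedes A B \<or> precedes B A"
  unfolding saturated_chain_def by (elim conjE) (drule (1) bspec, drule (1) bspec, assumption)

lemma saturated_chain_mem: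
  assumes "saturated_chain C" and "E \<in> events"
    and "\<And>A. A \<in> C \<Longrightarrow> A = E \<or> precedes A E \<or> precedes E A"
  shows "E \<in> C"
proof -
  have "\<forall>E\<in>events. (\<forall>A\<in>C. A = E \<or> precedes A E \<or> precedes E A) \<longrightarrow> E \<in> C"
    using assms(1) unfolding saturated_chain_def by (elim conjE)
  from this assms(2) have "(\<forall>A\<in>C. A = E \<or> precedes A E \<or> precedes E A) \<longrightarrow> E \<in> C"
    by (rule bspec)
  moreover have "\<forall>A\<in>C. A = E \<or> precedes A E \<or> precedes E A"
    using assms(3) by (rule ballI)
  ultimately show ?thesis by (rule mp)
qed

lemma precedes_compl:
  "A \<in> events \<Longrightarrow> B \<in> events \<Longrightarrow> precedes (space M - A) (space M - B) \<longleftrightarrow> precedes B A"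
  using sets.sets_into_space[of A M] sets.sets_into_space[of B M]
  by (auto simp: precedes_def prob_compl)

text \<open>Complementation reverses the order, so that every fact about suprema in saturated chains gives
  its counterpart for infima.\<close>

lemma saturated_chain_compl:
  assumes C: "saturated_chain C"
  shows "saturated_chain ((\<lambda>A. space M - A) ` C)"
proof -
  note ev = saturated_chain_events[OF C]
  have sat: "E \<in> (\<lambda>A. space M - A) ` C"
    if E: "E \<in> events"
      and cmp: "\<forall>A\<in>C. space M - A = E \<or> precedes (space M - A) E \<or> precedes E (space M - A)" for E
  proof -
    have E': "E = space M - (space M - E)" using sets.sets_into_space[OF E] by auto
    have "A = space M - E \<or> precedes A (space M - E) \<or> precedes (space M - E) A" if "A \<in> C" for A
    proof -
      have "A = space M - (space M - A)" using sets.sets_into_space[OF ev[OF that]] by auto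
      then show ?thesis
        using cmp that precedes_compl[OF ev[OF that], of "space M - E"]
          precedes_compl[OF _ ev[OF that], of "space M - E"] E E' by auto
    qed
    then have "space M - E \<in> C"
      by (rule saturated_chain_mem[OF C sets.compl_sets[OF E]])
    with E' show ?thesis by blast
  qed
  have tot: "space M - A = space M - B \<or> precedes (space M - A) (space M - B)
      \<or> precedes (space M - B) (space M - A)" if A: "A \<in> C" and B: "B \<in> C" for A B
  proof -
    have "A = B \<or> precedes A B \<or> precedes B A"
      by (rule saturated_chain_total[OF C A B])
    then show ?thesis
      using precedes_compl[OF ev[OF A] ev[OF B]] precedes_compl[OF ev[OF B] ev[OF A]] by blast
  qed
  show ?thesis
    unfolding saturated_chain_def
  proof (intro conjI ballI impI)
    show "(\<lambda>A. space M - A) ` C \<subseteq> events" using ev by blast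
  next
    fix A B assume "A \<in> (\<lambda>A. space M - A) ` C" "B \<in> (\<lambda>A. space M - A) ` C"
    then show "A = B \<or> precedes A B \<or> precedes B A" using tot by blast
  next
    fix E assume "E \<in> events"
      "\<forall>A\<in>(\<lambda>A. space M - A) ` C. A = E \<or> precedes A E \<or> precedes E A"
    then show "E \<in> (\<lambda>A. space M - A) ` C" by (intro sat) simp_all
  qed
qed

text \<open>If no member has probability \<open>s\<close>, then the union of members with probabilities tending to
  \<open>s\<close> from below is comparable to all members, and hence is a member of probability \<open>s\<close>.\<close>

lemma saturated_chain_attains_Sup:
  assumes C: "saturated_chain C"
    and approx: "\<And>e. e > 0 \<Longrightarrow> \<exists>A\<in>C. s - e < prob A \<and> prob A \<le> s"
  shows "\<exists>A\<in>C. prob A = s"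
proof (rule ccontr)
  assume no: "\<not> ?thesis"
  note ev = saturated_chain_events[OF C]
  note tot = saturated_chain_total[OF C]
  note sat = saturated_chain_mem[OF C]
  define f where "f n = (SOME A. A \<in> C \<and> s - 1 / real (Suc n) < prob A \<and> prob A \<le> s)" for n :: nat
  have "f n \<in> C \<and> s - 1 / real (Suc n) < prob (f n) \<and> prob (f n) \<le> s" for n
  proof -
    have "1 / real (Suc n) > 0" by simp
    from approx[OF this] have "\<exists>A. A \<in> C \<and> s - 1 / real (Suc n) < prob A \<and> prob A \<le> s" by (rule bexE) blast
    then show ?thesis unfolding f_def by (rule someI_ex)
  qed
  then have f: "f n \<in> C" "s - 1 / real (Suc n) < prob (f n)" "prob (f n) \<le> s" for n
    by simp_all
  define U where "U = (\<Union>n. f n)"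
  have not_s: "prob A \<noteq> s" if "A \<in> C" for A using no that by blast
  have fs: "prob (f n) < s" for n using f(3)[of n] not_s[OF f(1)[of n]] by simp
  have fin_image: "(\<Union>i\<le>n. f i) \<in> f ` {..n}" for n
  proof (rule Union_in_chain[where \<A> = UNIV])
    show "subset.chain UNIV (f ` {..n})"
      unfolding subset_chain_def using tot[OF f(1) f(1)] by (auto simp: precedes_def)
  qed auto
  have fin: "(\<Union>i\<le>n. f i) \<in> C" for n
  proof -
    obtain i where "(\<Union>i\<le>n. f i) = f i" using fin_image[of n] by (elim imageE)
    then show ?thesis using f(1) by simp
  qed
  have U_ev: "U \<in> events" unfolding U_def using f(1) ev by auto
  have "(\<lambda>n. prob (\<Union>i\<le>n. f i)) \<longlonglongrightarrow> prob (\<Union>n. \<Union>i\<le>n. f i)"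
  proof (rule finite_Lim_measure_incseq)
    show "range (\<lambda>n. \<Union>i\<le>n. f i) \<subseteq> events" using fin ev by blast
    show "incseq (\<lambda>n. \<Union>i\<le>n. f i)" unfolding incseq_def by (intro allI impI UN_mono) auto
  qed
  moreover have "(\<Union>n. \<Union>i\<le>n. f i) = U" unfolding U_def by auto
  moreover have "prob (\<Union>i\<le>n. f i) \<le> s" for n
  proof -
    obtain i where "(\<Union>i\<le>n. f i) = f i" using fin_image[of n] by (elim imageE)
    then show ?thesis using f(3) by simp
  qed
  ultimately have U_le: "prob U \<le> s" by (auto intro: LIMSEQ_le_const2)
  have near: "\<exists>n. x < prob (f n)" if "x < s" for x
  proof -
    have "0 < s - x" using that by simp
    then obtain n where "1 / real (Suc n) < s - x"
      by (rule nat_approx_posE)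
    then show ?thesis using f(2)[of n] by (intro exI[of _ n]) linarith
  qed
  have fU: "f n \<subseteq> U" for n
    unfolding U_def by auto
  have fU_prob: "prob (f n) \<le> prob U" for n
    by (rule finite_measure_mono[OF fU U_ev])
  have "\<not> prob U < s"
    using near[of "prob U"] fU_prob by (auto simp: not_le[symmetric])
  with U_le have U_s: "prob U = s" by simp
  have "A = U \<or> precedes A U \<or> precedes U A" if A: "A \<in> C" for A
  proof (cases "prob A < s")
    case True
    then obtain n where "prob A < prob (f n)" using near by blast
    then have "A \<subseteq> f n" using tot[OF A f(1)[of n]] by (auto simp: precedes_def)
    then show ?thesis using fU True U_s by (auto simp: precedes_def)
  next
    case False
    then have "prob A > s" using not_s[OF A] by simp
    moreover have "f n \<subseteq> A" for n
      using tot[OF A f(1)[of n]] fs[of n] \<open>prob A > s\<close> by (auto simp: precedes_def)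
    ultimately show ?thesis using U_s unfolding U_def by (auto simp: precedes_def)
  qed
  then have "U \<in> C" by (rule sat[OF U_ev])
  with U_s show False using not_s by simp
qed

lemma saturated_chain_attains_Inf:
  assumes C: "saturated_chain C"
    and approx: "\<And>e. e > 0 \<Longrightarrow> \<exists>A\<in>C. s \<le> prob A \<and> prob A < s + e"
  shows "\<exists>A\<in>C. prob A = s"
proof -
  note ev = saturated_chain_events[OF C]
  have "\<exists>A\<in>(\<lambda>A. space M - A) ` C. prob A = 1 - s"
  proof (rule saturated_chain_attains_Sup[OF saturated_chain_compl[OF C]])
    fix e :: real assume "e > 0"
    then obtain A where "A \<in> C" "s \<le> prob A" "prob A < s + e" using approx by blast
    then show "\<exists>A\<in>(\<lambda>A. space M - A) ` C. 1 - s - e < prob A \<and> prob A \<le> 1 - s"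
      using ev[of A] by (intro bexI[of _ "space M - A"]) (auto simp: prob_compl)
  qed
  then obtain A where "A \<in> C" "prob (space M - A) = 1 - s" by blast
  then show ?thesis using prob_compl[OF ev[of A]] by (intro bexI[of _ A]) auto
qed

text \<open>A missing value \<open>t\<close> would lie in a gap between consecutive members \<open>A\<close> and \<open>B\<close> of the
  chain. By atomlessness, the difference \<open>B - A\<close> has a part \<open>E\<close> of strictly intermediate
  probability, and then \<open>A \<union> E\<close> would be one more member inside the gap.\<close>

lemma saturated_chain_prob_surj:
  assumes "atomless M" and C: "saturated_chain C" and t: "0 \<le> t" "t \<le> 1"
  shows "\<exists>A\<in>C. prob A = t"
proof (rule ccontr)
  assume no: "\<not> ?thesis"
  note ev = saturated_chain_events[OF C]
  note tot = saturated_chain_total[OF C]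
  note sat = saturated_chain_mem[OF C]
  have "\<exists>A\<in>C. prob A = 0"
  proof (rule ccontr)
    assume "\<not> ?thesis"
    then have "precedes {} A" if "A \<in> C" for A
      using that measure_nonneg[of M A] by (auto simp: precedes_def less_eq_real_def)
    then have "{} \<in> C" using sat[of "{}"] by auto
    with \<open>\<not> ?thesis\<close> show False by (metis measure_empty)
  qed
  moreover have "\<exists>A\<in>C. prob A = 1"
  proof (rule ccontr)
    assume "\<not> ?thesis"
    then have "precedes A (space M)" if "A \<in> C" for A
      using that sets.sets_into_space[OF ev[OF that]] prob_le_1[of A]
      by (auto simp: precedes_def prob_space less_eq_real_def)
    then have "space M \<in> C" using sat[of "space M"] by auto
    with \<open>\<not> ?thesis\<close> show False by (metis prob_space)
  qed
  ultimately obtain A0 A1 where A01: "A0 \<in> C" "prob A0 = 0" "A1 \<in> C" "prob A1 = 1" by blast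
  define L where "L = {prob A |A. A \<in> C \<and> prob A < t}"
  define H where "H = {prob A |A. A \<in> C \<and> t < prob A}"
  have L: "L \<noteq> {}" "bdd_above L"
    using A01 t no unfolding L_def by (auto simp: less_eq_real_def intro!: bdd_aboveI[of _ 1])
  have H: "H \<noteq> {}" "bdd_below H"
    using A01 t no unfolding H_def by (auto simp: less_eq_real_def intro!: bdd_belowI[of _ 0])
  have "\<exists>A\<in>C. prob A = Sup L"
  proof (rule saturated_chain_attains_Sup[OF C])
    fix e :: real assume "e > 0"
    then obtain l where "l \<in> L" "Sup L - e < l" using less_cSupE[of "Sup L - e" L] L by auto
    then show "\<exists>A\<in>C. Sup L - e < prob A \<and> prob A \<le> Sup L"
      using cSup_upper[OF _ L(2)] unfolding L_def by blast
  qed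
  then obtain A where A: "A \<in> C" "prob A = Sup L" by blast
  have "\<exists>A\<in>C. prob A = Inf H"
  proof (rule saturated_chain_attains_Inf[OF C])
    fix e :: real assume "e > 0"
    then obtain l where "l \<in> H" "l < Inf H + e" using cInf_lessD[of H "Inf H + e"] H by auto
    then show "\<exists>A\<in>C. Inf H \<le> prob A \<and> prob A < Inf H + e"
      using cInf_lower[OF _ H(2)] unfolding H_def by blast
  qed
  then obtain B where B: "B \<in> C" "prob B = Inf H" by blast
  have "Sup L \<le> t" using L(1) by (intro cSup_least) (auto simp: L_def)
  then have At: "prob A < t" using A no by force
  have "t \<le> Inf H" using H(1) by (intro cInf_greatest) (auto simp: H_def)
  then have tB: "t < prob B" using B no by force
  have AB: "A \<subseteq> B" using tot[OF A(1) B(1)] At tB by (auto simp: precedes_def)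
  have gap: "prob A' \<le> prob A \<or> prob B \<le> prob A'" if "A' \<in> C" for A'
  proof (cases "prob A' < t")
    case True
    then show ?thesis using that A(2) cSup_upper[OF _ L(2)] unfolding L_def by auto
  next
    case False
    then have "t < prob A'" using that no by force
    then show ?thesis using that B(2) cInf_lower[OF _ H(2)] unfolding H_def by auto
  qed
  have "prob (B - A) = prob B - prob A"
    using AB A B ev by (simp add: finite_measure_Diff)
  then have "0 < emeasure M (B - A)"
    using At tB by (simp add: emeasure_eq_measure)
  then obtain E where E: "E \<in> events" "E \<subseteq> B - A" "0 < emeasure M E" "emeasure M E < emeasure M (B - A)"
    using \<open>atomless M\<close> ev[OF A(1)] ev[OF B(1)] unfolding atomless_def by (meson sets.Diff)
  have E': "0 < prob E" "prob E < prob B - prob A"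
    using E \<open>prob (B - A) = _\<close> by (auto simp: emeasure_eq_measure ennreal_less_iff)
  have AE: "prob (A \<union> E) = prob A + prob E"
    using E(1,2) ev[OF A(1)] by (intro finite_measure_Union) auto
  have "A \<union> E \<in> C"
  proof (rule sat)
    fix A' assume A': "A' \<in> C"
    from gap[OF this] show "A' = A \<union> E \<or> precedes A' (A \<union> E) \<or> precedes (A \<union> E) A'"
    proof
      assume "prob A' \<le> prob A"
      then have "A' \<subseteq> A" using tot[OF A' A(1)] by (auto simp: precedes_def)
      then show ?thesis using AE E' \<open>prob A' \<le> prob A\<close> by (auto simp: precedes_def)
    next
      assume "prob B \<le> prob A'"
      then have "B \<subseteq> A'" using tot[OF A' B(1)] by (auto simp: precedes_def)
      then show ?thesis using AE E' \<open>prob B \<le> prob A'\<close> AB E(2) by (auto simp: precedes_def)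
    qed
  qed (use E(1) ev[OF A(1)] in auto)
  from gap[OF this] show False using AE E' by linarith
qed

lemma atomless_increasing_events:
  assumes "atomless M"
  obtains D where "\<And>t. 0 \<le> t \<Longrightarrow> t \<le> 1 \<Longrightarrow> D t \<in> events \<and> prob (D t) = t"
    and "\<And>s t. 0 \<le> s \<Longrightarrow> s \<le> t \<Longrightarrow> t \<le> 1 \<Longrightarrow> D s \<subseteq> D t"
proof -
  obtain C where C: "saturated_chain C" using saturated_chain_exists ..
  note ev = saturated_chain_events[OF C]
  note tot = saturated_chain_total[OF C]
  have "\<forall>t\<in>{0..1}. \<exists>A\<in>C. prob A = t"
    using saturated_chain_prob_surj[OF assms C] by auto
  then obtain D where D: "\<And>t. t \<in> {0..1} \<Longrightarrow> D t \<in> C \<and> prob (D t) = t"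
    by metis
  show ?thesis
  proof (rule that[of D])
    fix s t :: real assume st: "0 \<le> s" "s \<le> t" "t \<le> 1"
    then show "D s \<subseteq> D t"
      using tot[of "D s" "D t"] D[of s] D[of t] by (auto simp: precedes_def)
  qed (use D ev in auto)
qed

text \<open>The variable sends \<open>\<omega>\<close> to the first level \<open>t\<close> at which \<open>\<omega>\<close> enters the nested events
  \<open>D t\<close>. The endpoints of \<open>[0, 1]\<close> are avoided pointwise because quantile functions are well
  behaved on the open interval only.\<close>

lemma atomless_uniform_variable:
  assumes "atomless M"
  obtains U where "U \<in> borel_measurable M" and "\<And>\<omega>. 0 < U \<omega> \<and> U \<omega> < (1::real)"
    and "\<And>x. 0 \<le> x \<Longrightarrow> x \<le> 1 \<Longrightarrow> prob {\<omega>\<in>space M. U \<omega> \<le> x} = x"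
proof -
  obtain D where D: "\<And>t. 0 \<le> t \<Longrightarrow> t \<le> 1 \<Longrightarrow> D t \<in> events \<and> prob (D t) = t"
    and mono: "\<And>s t. 0 \<le> s \<Longrightarrow> s \<le> t \<Longrightarrow> t \<le> 1 \<Longrightarrow> D s \<subseteq> D t"
    using atomless_increasing_events[OF assms] by blast
  \<comment> \<open>The value 1 is inserted for the points outside of every \<open>D t\<close>, which form a null set.\<close>
  define S where "S \<omega> = insert 1 {t. 0 \<le> t \<and> t \<le> 1 \<and> \<omega> \<in> D t}" for \<omega>
  define U where "U \<omega> = Inf (S \<omega>)" for \<omega>
  have S: "S \<omega> \<noteq> {}" "bdd_below (S \<omega>)" for \<omega>
    unfolding S_def by (auto intro!: bdd_belowI[of _ 0])
  have U01: "0 \<le> U \<omega>" "U \<omega> \<le> 1" for \<omega>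
    using S unfolding U_def by (auto intro!: cInf_greatest cInf_lower simp: S_def)
  have less: "U \<omega> < x \<longleftrightarrow> (\<exists>t. 0 \<le> t \<and> t < x \<and> \<omega> \<in> D t)" if "x \<le> 1" for \<omega> x
    unfolding U_def cInf_less_iff[OF S] using that by (auto simp: S_def)
  have less_Rats: "{\<omega>\<in>space M. U \<omega> < x} = (\<Union>q\<in>{q\<in>\<rat>. 0 \<le> q \<and> q < x}. D q)" if "x \<le> 1" for x
  proof -
    have "\<exists>q\<in>\<rat>. 0 \<le> q \<and> q < x \<and> \<omega> \<in> D q" if t: "0 \<le> t" "t < x" "\<omega> \<in> D t" for \<omega> t
    proof -
      obtain q where "q \<in> \<rat>" "t < q" "q < x" using Rats_dense_in_real[OF t(2)] by blast
      moreover have "D t \<subseteq> D q" using mono[of t q] t calculation \<open>x \<le> 1\<close> by auto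
      ultimately show ?thesis using t by (intro bexI[of _ q]) auto
    qed
    moreover have "D q \<subseteq> space M" if "0 \<le> q" "q < x" for q
      using D[of q] that \<open>x \<le> 1\<close> by (intro sets.sets_into_space) auto
    ultimately show ?thesis
      unfolding less[OF that] by blast
  qed
  have U_meas: "U \<in> borel_measurable M"
    unfolding borel_measurable_iff_less
  proof
    fix x
    show "{\<omega>\<in>space M. U \<omega> < x} \<in> events"
    proof (cases "x \<le> 1")
      case True
      have "countable {q\<in>\<rat>. 0 \<le> q \<and> q < x}"
        using countable_rat by (rule countable_subset[rotated]) auto
      then show ?thesis
        unfolding less_Rats[OF True] using D True by (intro sets.countable_UN') auto
    next
      case False
      then have "{\<omega>\<in>space M. U \<omega> < x} = space M" using U01(2) by (auto intro: le_less_trans[of _ 1])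
      then show ?thesis by simp
    qed
  qed
  have less_prob: "prob {\<omega>\<in>space M. U \<omega> < x} = x" if x: "0 \<le> x" "x \<le> 1" for x
  proof (rule antisym)
    have ev: "{\<omega>\<in>space M. U \<omega> < x} \<in> events" using U_meas by measurable
    have "{\<omega>\<in>space M. U \<omega> < x} \<subseteq> D x"
      using mono[of _ x] x unfolding less[OF x(2)] by force
    then show "prob {\<omega>\<in>space M. U \<omega> < x} \<le> x"
      using finite_measure_mono D[OF x] by metis
    show "x \<le> prob {\<omega>\<in>space M. U \<omega> < x}"
    proof (rule dense_le)
      fix y assume "y < x"
      show "y \<le> prob {\<omega>\<in>space M. U \<omega> < x}"
      proof (cases "0 \<le> y")
        case True
        then have "D y \<subseteq> {\<omega>\<in>space M. U \<omega> < x}"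
          using \<open>y < x\<close> x D[of y] sets.sets_into_space[of "D y" M] unfolding less[OF x(2)] by auto
        then show ?thesis
          using finite_measure_mono[OF _ ev, of "D y"] D[of y] True \<open>y < x\<close> x by auto
      qed (use measure_nonneg[of M] order_trans linear in metis)
    qed
  qed
  have le_prob: "prob {\<omega>\<in>space M. U \<omega> \<le> x} = x" if x: "0 \<le> x" "x \<le> 1" for x
  proof (cases "x = 1")
    case True
    then show ?thesis using U01 prob_space by simp
  next
    case False
    have ev: "{\<omega>\<in>space M. U \<omega> \<le> x} \<in> events" using U_meas by measurable
    have "x \<le> prob {\<omega>\<in>space M. U \<omega> \<le> x}"
      using finite_measure_mono[OF _ ev, of "{\<omega>\<in>space M. U \<omega> < x}"] less_prob[OF x] by fastforce
    moreover have "prob {\<omega>\<in>space M. U \<omega> \<le> x} \<le> x"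
    proof (rule dense_ge_bounded[of x 1])
      fix y assume "x < y" "y < 1"
      then have "prob {\<omega>\<in>space M. U \<omega> \<le> x} \<le> prob {\<omega>\<in>space M. U \<omega> < y}"
        using U_meas by (intro finite_measure_mono) (auto, measurable)
      then show "prob {\<omega>\<in>space M. U \<omega> \<le> x} \<le> y"
        using less_prob[of y] x \<open>x < y\<close> \<open>y < 1\<close> by auto
    qed (use x False in auto)
    ultimately show ?thesis by simp
  qed
  \<comment> \<open>The value \<open>1 / 2\<close> is used on a null set only.\<close>
  define V where "V \<omega> = (if 0 < U \<omega> \<and> U \<omega> < 1 then U \<omega> else 1 / 2)" for \<omega>
  have V_meas: "V \<in> borel_measurable M" unfolding V_def using U_meas by measurable
  have "prob {\<omega>\<in>space M. U \<omega> \<le> 0} = 0" "prob {\<omega>\<in>space M. U \<omega> < 1} = 1"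
    using le_prob[of 0] less_prob[of 1] by auto
  then have "AE \<omega> in M. \<not> U \<omega> \<le> 0" "AE \<omega> in M. U \<omega> < 1"
    using U_meas prob_Collect_eq_0[of "\<lambda>\<omega>. U \<omega> \<le> 0"] prob_Collect_eq_1[of "\<lambda>\<omega>. U \<omega> < 1"] by auto
  then have VU: "AE \<omega> in M. V \<omega> = U \<omega>" unfolding V_def by eventually_elim auto
  show ?thesis
  proof (rule that[of V])
    fix x :: real assume x: "0 \<le> x" "x \<le> 1"
    have "prob {\<omega>\<in>space M. V \<omega> \<le> x} = prob {\<omega>\<in>space M. U \<omega> \<le> x}"
      using VU U_meas V_meas by (intro finite_measure_eq_AE) auto
    then show "prob {\<omega>\<in>space M. V \<omega> \<le> x} = x" using le_prob x by simp
  qed (use V_meas in \<open>auto simp: V_def\<close>)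
qed

end


section \<open>Realising laws on an atomless space\<close>

text \<open>The choice \<open>q \<mu>\<close> is the quantile function of \<open>\<mu>\<close> at a uniform variable that is the same for
  all \<open>\<mu>\<close>. It therefore turns stochastic dominance into pointwise order.\<close>

lemma (in prob_space) atomless_realises_laws:
  assumes "atomless M"
  obtains q :: "real measure \<Rightarrow> 'a \<Rightarrow> real"
  where "\<And>\<mu>. real_distribution \<mu> \<Longrightarrow> q \<mu> \<in> borel_measurable M"
    and "\<And>\<mu>. real_distribution \<mu> \<Longrightarrow> distr M borel (q \<mu>) = \<mu>"
    and "\<And>\<mu> \<nu> \<omega>. real_distribution \<mu> \<Longrightarrow> real_distribution \<nu> \<Longrightarrow>
          (\<And>x. cdf \<nu> x \<le> cdf \<mu> x) \<Longrightarrow> q \<mu> \<omega> \<le> q \<nu> \<omega>"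
proof -
  obtain U where U: "U \<in> borel_measurable M" and U01: "\<And>\<omega>. 0 < U \<omega> \<and> U \<omega> < (1::real)"
    and U_prob: "\<And>x. 0 \<le> x \<Longrightarrow> x \<le> 1 \<Longrightarrow> prob {\<omega>\<in>space M. U \<omega> \<le> x} = x"
    using atomless_uniform_variable[OF assms] by blast
  define q where "q \<mu> \<omega> = Inf {x. U \<omega> \<le> cdf \<mu> x}" for \<mu> \<omega>
  \<comment> \<open>The Galois connection between a distribution function and its quantile function.\<close>
  have inverse: "U \<omega> \<le> cdf \<mu> x \<longleftrightarrow> q \<mu> \<omega> \<le> x" if "real_distribution \<mu>" for \<mu> \<omega> x
  proof -
    interpret \<mu>: cdf_distribution \<mu> using that by (simp add: cdf_distribution_def)
    show ?thesis unfolding q_def using U01[of \<omega>] by (intro \<mu>.pseudoinverse) auto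
  qed
  have q_meas: "q \<mu> \<in> borel_measurable M" if "real_distribution \<mu>" for \<mu>
    unfolding borel_measurable_iff_le inverse[OF that, symmetric]
    by (intro allI) (use U in measurable)
  show ?thesis
  proof (rule that[of q, OF q_meas])
    fix \<mu> :: "real measure" assume \<mu>: "real_distribution \<mu>"
    interpret \<mu>: real_distribution \<mu> by fact
    show "distr M borel (q \<mu>) = \<mu>"
    proof (rule cdf_unique)
      show "real_distribution (distr M borel (q \<mu>))" using q_meas[OF \<mu>] by simp
      show "cdf (distr M borel (q \<mu>)) = cdf \<mu>"
      proof
        fix x
        have "cdf (distr M borel (q \<mu>)) x = prob {\<omega>\<in>space M. q \<mu> \<omega> \<le> x}"
          unfolding cdf_def using q_meas[OF \<mu>] by (subst measure_distr) (auto intro!: arg_cong[where f="measure M"])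
        also have "\<dots> = cdf \<mu> x"
          unfolding inverse[OF \<mu>, symmetric]
          using \<mu>.cdf_nonneg[of x] \<mu>.cdf_bounded_prob[of x] by (rule U_prob)
        finally show "cdf (distr M borel (q \<mu>)) x = cdf \<mu> x" .
      qed
    qed (rule \<mu>)
  next
    fix \<mu> \<nu> :: "real measure" and \<omega>
    assume \<mu>: "real_distribution \<mu>" and \<nu>: "real_distribution \<nu>" and le: "\<And>x. cdf \<nu> x \<le> cdf \<mu> x"
    have "U \<omega> \<le> cdf \<nu> (q \<nu> \<omega>)" using inverse[OF \<nu>] by simp
    then have "U \<omega> \<le> cdf \<mu> (q \<nu> \<omega>)" using le order_trans by blast
    then show "q \<mu> \<omega> \<le> q \<nu> \<omega>" using inverse[OF \<mu>] by simp
  qed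
qed

lemma (in prob_space) distr_indicator_cong:
  assumes A: "A \<in> events" and B: "B \<in> events" and eq: "prob A = prob B"
  shows "distr M borel (indicator A :: 'a \<Rightarrow> real) = distr M borel (indicator B)"
proof (rule measure_eqI)
  fix S assume "S \<in> sets (distr M borel (indicator A :: 'a \<Rightarrow> real))"
  then have S: "S \<in> sets borel" by simp
  have "prob ((indicator A :: 'a \<Rightarrow> real) -` S \<inter> space M) = (if 1 \<in> S then prob A else 0) + (if 0 \<in> S then 1 - prob A else 0)"
    if A: "A \<in> events" for A
  proof -
    have sub: "A \<subseteq> space M" using A by (rule sets.sets_into_space)
    have "(indicator A :: 'a \<Rightarrow> real) -` S \<inter> space M =
        (if 1 \<in> S then A else {}) \<union> (if 0 \<in> S then space M - A else {})"
      using sub by (auto simp: indicator_def of_bool_def split: if_splits)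
    then show ?thesis
      using A sub prob_compl[OF A] by (auto simp: Un_absorb1 prob_space)
  qed
  from this[OF A] this[OF B] show "emeasure (distr M borel (indicator A :: 'a \<Rightarrow> real)) S = emeasure (distr M borel (indicator B)) S"
    using A B S eq by (simp add: emeasure_distr emeasure_eq_measure)
qed simp

section \<open>The induced risk functional on arbitrary probability spaces\<close>

context law_invariant_coherent_risk_measure
begin

text \<open>Couplings live on product spaces and not on \<open>\<Omega>\<close>. The functional below evaluates \<open>\<rho>\<close> on
  random variables over any probability space by way of their law.\<close>

definition risk :: "'b measure \<Rightarrow> ('b \<Rightarrow> real) \<Rightarrow> ereal" where
  "risk M V = risk_of_law \<Omega> \<rho> (distr M borel V)"

lemma risk_eqI:
  assumes "X \<in> nonneg_rvs \<Omega>" and "distr \<Omega> borel X = distr M borel V"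
  shows "risk M V = \<rho> X"
  unfolding risk_def assms(2)[symmetric] by (rule risk_of_law_distr[OF assms(1)])

lemma nonneg_rvsD: "X \<in> nonneg_rvs \<Omega> \<Longrightarrow> X \<in> borel_measurable \<Omega>"
  by (simp add: nonneg_rvs_def)

text \<open>Realised variables are non-negative almost surely only, whereas the domain of \<open>\<rho>\<close> asks for
  this everywhere. Truncation at 0 mends this without changing the law.\<close>

lemma distr_max_0:
  assumes V: "V \<in> borel_measurable M" and "AE \<omega> in M. 0 \<le> V \<omega>"
    and X: "X \<in> borel_measurable \<Omega>" and eq: "distr \<Omega> borel X = distr M borel V"
  shows "distr \<Omega> borel (\<lambda>\<omega>. max 0 (X \<omega>)) = distr M borel (V :: _ \<Rightarrow> real)"
proof -
  have "distr \<Omega> borel (\<lambda>\<omega>. max 0 (X \<omega>)) = distr (distr \<Omega> borel X) borel (max 0)"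
    using X by (subst distr_distr) (auto simp: comp_def)
  also have "\<dots> = distr M borel (\<lambda>\<omega>. max 0 (V \<omega>))"
    unfolding eq using V by (subst distr_distr) (auto simp: comp_def)
  also have "\<dots> = distr M borel V"
    using V assms(2) by (intro distr_cong_AE) (auto elim: eventually_mono)
  finally show ?thesis .
qed

lemma realise_pair_ordered:
  assumes M: "prob_space M" and V: "V \<in> borel_measurable M" and W: "W \<in> borel_measurable M"
    and pos: "AE \<omega> in M. 0 \<le> V \<omega>" and le: "AE \<omega> in M. V \<omega> \<le> W \<omega>"
  obtains X Y where "X \<in> nonneg_rvs \<Omega>" "Y \<in> nonneg_rvs \<Omega>" "\<And>\<omega>. X \<omega> \<le> Y \<omega>"
    "distr \<Omega> borel X = distr M borel V" "distr \<Omega> borel Y = distr M borel W"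
proof -
  interpret M: prob_space M by (rule M)
  obtain q :: "real measure \<Rightarrow> 'w \<Rightarrow> real" where
    q: "\<And>\<mu>. real_distribution \<mu> \<Longrightarrow> q \<mu> \<in> borel_measurable \<Omega>"
      "\<And>\<mu>. real_distribution \<mu> \<Longrightarrow> distr \<Omega> borel (q \<mu>) = \<mu>"
      "\<And>\<mu> \<nu> \<omega>. real_distribution \<mu> \<Longrightarrow> real_distribution \<nu> \<Longrightarrow>
          (\<And>x. cdf \<nu> x \<le> cdf \<mu> x) \<Longrightarrow> q \<mu> \<omega> \<le> q \<nu> \<omega>"
    using atomless_realises_laws[OF atomless] by blast
  let ?\<mu> = "distr M borel V" and ?\<nu> = "distr M borel W"
  have \<mu>: "real_distribution ?\<mu>" and \<nu>: "real_distribution ?\<nu>" using V W by auto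
  have "cdf ?\<nu> x \<le> cdf ?\<mu> x" for x
  proof -
    have "cdf ?\<nu> x = measure M {\<omega>\<in>space M. W \<omega> \<le> x}" "cdf ?\<mu> x = measure M {\<omega>\<in>space M. V \<omega> \<le> x}"
      unfolding cdf_def using V W by (auto simp: measure_distr intro!: arg_cong[where f="measure M"])
    moreover have "measure M {\<omega>\<in>space M. W \<omega> \<le> x} \<le> measure M {\<omega>\<in>space M. V \<omega> \<le> x}"
      using le V W by (intro M.finite_measure_mono_AE) (auto elim: eventually_mono)
    ultimately show ?thesis by simp
  qed
  then have "q ?\<mu> \<omega> \<le> q ?\<nu> \<omega>" for \<omega> by (rule q(3)[OF \<mu> \<nu>])
  then have "max 0 (q ?\<mu> \<omega>) \<le> max 0 (q ?\<nu> \<omega>)" for \<omega> by (rule max.mono[OF order_refl])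
  moreover have "AE \<omega> in M. 0 \<le> W \<omega>" using pos le by eventually_elim simp
  ultimately show ?thesis
    using q(1,2)[OF \<mu>] q(1,2)[OF \<nu>] V W pos
    by (intro that[of "\<lambda>\<omega>. max 0 (q ?\<mu> \<omega>)" "\<lambda>\<omega>. max 0 (q ?\<nu> \<omega>)"] distr_max_0)
      (auto simp: nonneg_rvs_def)
qed

lemma realise:
  assumes "prob_space M" and "V \<in> borel_measurable M" and "AE \<omega> in M. 0 \<le> V \<omega>"
  obtains X where "X \<in> nonneg_rvs \<Omega>" "distr \<Omega> borel X = distr M borel V" "risk M V = \<rho> X"
  using realise_pair_ordered[OF assms(1,2,2,3)] risk_eqI by (metis AE_I2 order_refl)

lemma risk_mono:
  assumes "prob_space M" and "V \<in> borel_measurable M" and "W \<in> borel_measurable M"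
    and "AE \<omega> in M. 0 \<le> V \<omega>" and "AE \<omega> in M. V \<omega> \<le> W \<omega>"
  shows "risk M V \<le> risk M W"
  using realise_pair_ordered[OF assms] risk_eqI monotonicity by metis

lemma rho_nonneg: "X \<in> nonneg_rvs \<Omega> \<Longrightarrow> 0 \<le> \<rho> X"
  using monotonicity[of X "\<lambda>_. 0"] zero by (auto simp: nonneg_rvs_def)

lemma risk_nonneg:
  assumes "prob_space M" and "V \<in> borel_measurable M" and "AE \<omega> in M. 0 \<le> V \<omega>"
  shows "0 \<le> risk M V"
  using realise[OF assms] rho_nonneg by metis

lemma risk_add_const:
  assumes M: "prob_space M" and V: "V \<in> borel_measurable M" and "AE \<omega> in M. 0 \<le> V \<omega>" and c: "0 \<le> c"
  shows "risk M (\<lambda>\<omega>. V \<omega> + c) = risk M V + ereal c"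
proof -
  obtain X where X: "X \<in> nonneg_rvs \<Omega>" "distr \<Omega> borel X = distr M borel V" "risk M V = \<rho> X"
    using realise[OF assms(1-3)] .
  have "distr \<Omega> borel (\<lambda>\<omega>. X \<omega> + c) = distr (distr \<Omega> borel X) borel (\<lambda>x. x + c)"
    using nonneg_rvsD[OF X(1)] by (subst distr_distr) (auto simp: comp_def)
  also have "\<dots> = distr M borel (\<lambda>\<omega>. V \<omega> + c)"
    unfolding X(2) using V by (subst distr_distr) (auto simp: comp_def)
  finally have "risk M (\<lambda>\<omega>. V \<omega> + c) = \<rho> (\<lambda>\<omega>. X \<omega> + c)"
    using X(1) c by (intro risk_eqI) (auto simp: nonneg_rvs_def)
  then show ?thesis using translation_invariance[OF X(1) c] X(3) by simp
qed

text \<open>A joint law on a countable space can be realised on \<open>\<Omega>\<close> through the law of its code. All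
  functions of the code are then realised simultaneously, with one and the same \<open>k\<close>.\<close>

lemma realise_nat:
  assumes M: "prob_space M" and K[measurable]: "K \<in> M \<rightarrow>\<^sub>M count_space (UNIV :: nat set)"
  obtains k where "k \<in> \<Omega> \<rightarrow>\<^sub>M count_space (UNIV :: nat set)"
    and "\<And>h :: nat \<Rightarrow> real. distr \<Omega> borel (\<lambda>\<omega>. h (k \<omega>)) = distr M borel (\<lambda>\<omega>. h (K \<omega>))"
proof -
  obtain X where X: "X \<in> nonneg_rvs \<Omega>" "distr \<Omega> borel X = distr M borel (\<lambda>\<omega>. real (K \<omega>))"
    using realise[OF M, of "\<lambda>\<omega>. real (K \<omega>)"] by auto
  note [measurable] = nonneg_rvsD[OF X(1)]
  have [measurable]: "(\<lambda>x::real. nat \<lfloor>x\<rfloor>) \<in> borel \<rightarrow>\<^sub>M count_space UNIV"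
    by measurable
  show ?thesis
  proof (rule that[of "\<lambda>\<omega>. nat \<lfloor>X \<omega>\<rfloor>"])
    fix h :: "nat \<Rightarrow> real"
    have [measurable]: "(\<lambda>x. h (nat \<lfloor>x\<rfloor>)) \<in> borel_measurable (borel :: real measure)"
      by (rule measurable_compose[of _ _ "count_space UNIV"]) auto
    have "distr \<Omega> borel (\<lambda>\<omega>. h (nat \<lfloor>X \<omega>\<rfloor>)) = distr (distr \<Omega> borel X) borel (\<lambda>x. h (nat \<lfloor>x\<rfloor>))"
      by (subst distr_distr) (auto simp: comp_def)
    also have "\<dots> = distr M borel (\<lambda>\<omega>. h (K \<omega>))"
      unfolding X(2) by (subst distr_distr) (auto simp: comp_def)
    finally show "distr \<Omega> borel (\<lambda>\<omega>. h (nat \<lfloor>X \<omega>\<rfloor>)) = distr M borel (\<lambda>\<omega>. h (K \<omega>))" .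
  qed measurable
qed

lemma risk_subadditive_grid:
  assumes M: "prob_space M" and i[measurable]: "i \<in> M \<rightarrow>\<^sub>M count_space (UNIV :: nat set)"
    and j[measurable]: "j \<in> M \<rightarrow>\<^sub>M count_space (UNIV :: nat set)" and e: "0 \<le> e"
  shows "risk M (\<lambda>\<omega>. e * real (i \<omega>) + e * real (j \<omega>)) \<le>
    risk M (\<lambda>\<omega>. e * real (i \<omega>)) + risk M (\<lambda>\<omega>. e * real (j \<omega>))"
proof -
  \<comment> \<open>One code carries both coordinates, so that their sum is realised as well.\<close>
  have K: "(\<lambda>\<omega>. prod_encode (i \<omega>, j \<omega>)) \<in> M \<rightarrow>\<^sub>M count_space UNIV"
    by measurable
  obtain k where k: "k \<in> \<Omega> \<rightarrow>\<^sub>M count_space (UNIV :: nat set)"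
    and eq: "\<And>h :: nat \<Rightarrow> real. distr \<Omega> borel (\<lambda>\<omega>. h (k \<omega>)) = distr M borel (\<lambda>\<omega>. h (prod_encode (i \<omega>, j \<omega>)))"
    using realise_nat[OF M K] by blast
  define f where "f n = e * real (fst (prod_decode n))" for n
  define g where "g n = e * real (snd (prod_decode n))" for n
  have rv: "(\<lambda>\<omega>. h (k \<omega>)) \<in> nonneg_rvs \<Omega>" if "\<And>n. 0 \<le> h n" for h :: "nat \<Rightarrow> real"
    using that measurable_compose[OF k, of h borel] by (auto simp: nonneg_rvs_def)
  have risk: "risk M (\<lambda>\<omega>. h (prod_encode (i \<omega>, j \<omega>))) = \<rho> (\<lambda>\<omega>. h (k \<omega>))" if "\<And>n. 0 \<le> h n" for h
    using rv[OF that] eq by (rule risk_eqI)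
  have pos: "0 \<le> f n" "0 \<le> g n" "0 \<le> f n + g n" for n using e by (auto simp: f_def g_def)
  have "\<rho> (\<lambda>\<omega>. f (k \<omega>) + g (k \<omega>)) \<le> \<rho> (\<lambda>\<omega>. f (k \<omega>)) + \<rho> (\<lambda>\<omega>. g (k \<omega>))"
    using rv[of f] rv[of g] pos by (intro subadditivity) auto
  then show ?thesis
    using risk[of f] risk[of g] risk[of "\<lambda>n. f n + g n"] pos by (simp add: f_def g_def)
qed

text \<open>Rounding both variables up to the grid of mesh \<open>e\<close> raises each risk by at most \<open>e\<close>, and on the
  grid the pair can be realised jointly.\<close>

lemma risk_subadditive:
  assumes M: "prob_space M" and V[measurable]: "V \<in> borel_measurable M" and W[measurable]: "W \<in> borel_measurable M"
    and posV: "AE \<omega> in M. 0 \<le> V \<omega>" and posW: "AE \<omega> in M. 0 \<le> W \<omega>"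
  shows "risk M (\<lambda>\<omega>. V \<omega> + W \<omega>) \<le> risk M V + risk M W"
proof (rule ereal_le_epsilon2)
  fix e' :: real assume "0 < e'"
  define e where "e = e' / 2"
  have e: "0 < e" using \<open>0 < e'\<close> by (simp add: e_def)
  define up where "up x = nat \<lceil>x / e\<rceil>" for x :: real
  have [measurable]: "up \<in> borel \<rightarrow>\<^sub>M count_space UNIV" unfolding up_def by measurable
  have up: "x \<le> e * real (up x)" "e * real (up x) \<le> x + e" if "0 \<le> x" for x
  proof -
    have "real (up x) = of_int \<lceil>x / e\<rceil>" unfolding up_def using that e by simp
    then have "x / e \<le> real (up x)" "real (up x) \<le> x / e + 1" by linarith+
    then show "x \<le> e * real (up x)" "e * real (up x) \<le> x + e" using e by (auto simp: field_simps)
  qed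
  have grid: "risk M (\<lambda>\<omega>. e * real (up (X \<omega>))) \<le> risk M X + ereal e"
    if [measurable]: "X \<in> borel_measurable M" and "AE \<omega> in M. 0 \<le> X \<omega>" for X
  proof -
    have "risk M (\<lambda>\<omega>. e * real (up (X \<omega>))) \<le> risk M (\<lambda>\<omega>. X \<omega> + e)"
      using that(2) up e by (intro risk_mono[OF M]) (auto elim: eventually_mono)
    then show ?thesis using risk_add_const[OF M that, of e] e by simp
  qed
  have "risk M (\<lambda>\<omega>. V \<omega> + W \<omega>) \<le> risk M (\<lambda>\<omega>. e * real (up (V \<omega>)) + e * real (up (W \<omega>)))"
  proof (intro risk_mono[OF M])
    show "AE \<omega> in M. 0 \<le> V \<omega> + W \<omega>" using posV posW by eventually_elim simp
    show "AE \<omega> in M. V \<omega> + W \<omega> \<le> e * real (up (V \<omega>)) + e * real (up (W \<omega>))"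
      using posV posW by eventually_elim (intro add_mono up)
  qed measurable
  also have "\<dots> \<le> risk M (\<lambda>\<omega>. e * real (up (V \<omega>))) + risk M (\<lambda>\<omega>. e * real (up (W \<omega>)))"
    using e by (intro risk_subadditive_grid[OF M]) auto
  also have "\<dots> \<le> (risk M V + ereal e) + (risk M W + ereal e)"
    by (intro add_mono grid V W posV posW)
  also have "\<dots> = risk M V + risk M W + (ereal e + ereal e)"
    by (simp only: ac_simps)
  also have "ereal e + ereal e = ereal e'" by (simp add: e_def)
  finally show "risk M (\<lambda>\<omega>. V \<omega> + W \<omega>) \<le> risk M V + risk M W + ereal e'" .
qed

section \<open>Lower bounds for the risk of large deviations\<close>

lemma indicator_rv: "A \<in> events \<Longrightarrow> indicator A \<in> nonneg_rvs \<Omega>"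
  by (auto simp: nonneg_rvs_def)

lemma rho_indicator_cong:
  "A \<in> events \<Longrightarrow> B \<in> events \<Longrightarrow> prob A = prob B \<Longrightarrow> \<rho> (indicator A) = \<rho> (indicator B)"
  by (intro law_invariance indicator_rv distr_indicator_cong)

lemma rho_indicator_space: "\<rho> (indicator (space \<Omega>)) = 1"
proof -
  have "\<rho> (\<lambda>\<omega>. 0 + 1) = \<rho> (\<lambda>\<omega>. 0) + ereal 1"
    by (rule translation_invariance) (auto simp: nonneg_rvs_def)
  then have "\<rho> (\<lambda>_. 1) = 1" using zero by (simp add: one_ereal_def)
  moreover have "\<rho> (indicator (space \<Omega>)) = \<rho> (\<lambda>_. 1)"
    by (rule antisym; rule monotonicity) (auto simp: nonneg_rvs_def)
  ultimately show ?thesis by simp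
qed

text \<open>A lower bound of this kind usually comes from \<open>\<rho> X \<ge> E X\<close>. For indicators it is elementary: the
  increments of the nested events \<open>D (k / n)\<close> all have probability \<open>1 / n\<close>, hence the same risk,
  and \<open>n\<close> of them make up an event of probability 1.\<close>

lemma rho_indicator_ge:
  assumes n: "0 < n" and A: "A \<in> events" and pA: "1 / real n \<le> prob A"
  shows "1 \<le> ereal (real n) * \<rho> (indicator A)"
proof -
  obtain D where D: "\<And>t. 0 \<le> t \<Longrightarrow> t \<le> 1 \<Longrightarrow> D t \<in> events \<and> prob (D t) = t"
    and mono: "\<And>s t. 0 \<le> s \<Longrightarrow> s \<le> t \<Longrightarrow> t \<le> 1 \<Longrightarrow> D s \<subseteq> D t"
    using atomless_increasing_events[OF atomless] by blast
  let ?r = "\<rho> (indicator (D (1 / real n)))"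
  have "\<rho> (indicator (D (real k / real n))) \<le> ereal (real k) * ?r" if "k \<le> n" for k
    using that
  proof (induction k)
    case 0
    have "\<rho> (indicator (D 0)) = \<rho> (indicator {})" using D[of 0] by (intro rho_indicator_cong) auto
    then show ?case using zero by (simp add: indicator_def[abs_def] zero_ereal_def[symmetric])
  next
    case (Suc k)
    let ?s = "real k / real n" and ?t = "real (Suc k) / real n"
    have st: "0 \<le> ?s" "?s \<le> ?t" "?t \<le> 1" "?t - ?s = 1 / real n"
      using Suc.prems n by (auto simp: field_simps)
    note Ds = D[of ?s] D[of ?t] mono[of ?s ?t]
    have Dn: "D (1 / real n) \<in> events" "prob (D (1 / real n)) = 1 / real n"
      using D[of "1 / real n"] n by auto
    have sub: "D ?s \<subseteq> D ?t" and ev: "D ?s \<in> events" "D ?t \<in> events"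
      and pr: "prob (D ?s) = ?s" "prob (D ?t) = ?t"
      using Ds st by auto
    have "prob (D ?t - D ?s) = 1 / real n"
      using finite_measure_Diff[OF ev(2,1) sub] pr st(4) by simp
    then have step: "\<rho> (indicator (D ?t - D ?s)) = ?r"
      using ev Dn by (intro rho_indicator_cong) auto
    have "(indicator (D ?t) :: 'w \<Rightarrow> real) = (\<lambda>\<omega>. indicator (D ?s) \<omega> + indicator (D ?t - D ?s) \<omega>)"
      using sub by (auto simp: fun_eq_iff indicator_def)
    then have "\<rho> (indicator (D ?t)) \<le> \<rho> (indicator (D ?s)) + \<rho> (indicator (D ?t - D ?s))"
      using subadditivity[OF indicator_rv indicator_rv, of "D ?s" "D ?t - D ?s"] ev by simp
    also have "\<dots> \<le> ereal (real k) * ?r + 1 * ?r"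
      unfolding step using Suc by (intro add_mono) auto
    also have "\<dots> = ereal (real (Suc k)) * ?r"
      using rho_nonneg[OF indicator_rv[OF Dn(1)]]
      by (subst ereal_left_distrib[symmetric]) (auto simp: one_ereal_def add.commute)
    finally show ?case .
  qed
  from this[of n] have "\<rho> (indicator (D 1)) \<le> ereal (real n) * ?r" using n by simp
  moreover have "\<rho> (indicator (D 1)) = 1"
    using rho_indicator_cong[of "D 1" "space \<Omega>"] D[of 1] rho_indicator_space prob_space by simp
  moreover have "?r \<le> \<rho> (indicator A)"
  proof -
    have "?r \<le> \<rho> (indicator (D (prob A)))"
      using D[of "1 / real n"] D[of "prob A"] mono[of "1 / real n" "prob A"] pA n
      by (intro monotonicity indicator_rv) (auto simp: indicator_def)
    also have "\<dots> = \<rho> (indicator A)"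
      using D[of "prob A"] A by (intro rho_indicator_cong) auto
    finally show ?thesis .
  qed
  then have "ereal (real n) * ?r \<le> ereal (real n) * \<rho> (indicator A)"
    by (intro ereal_mult_left_mono) auto
  ultimately show ?thesis by simp
qed

lemma risk_ge_of_tail:
  assumes M: "prob_space M" and V: "V \<in> borel_measurable M" and pos: "AE \<omega> in M. 0 \<le> V \<omega>"
    and n: "0 < n" and e: "0 < e" and tail: "1 / real n \<le> measure M {\<omega>\<in>space M. e \<le> V \<omega>}"
  shows "ereal (e / real n) \<le> risk M V"
proof -
  obtain X where X: "X \<in> nonneg_rvs \<Omega>" "distr \<Omega> borel X = distr M borel V" "risk M V = \<rho> X"
    using realise[OF M V pos] .
  note [measurable] = nonneg_rvsD[OF X(1)]
  let ?A = "{\<omega>\<in>space \<Omega>. e \<le> X \<omega>}"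
  have A: "?A \<in> events" by measurable
  have "prob ?A = measure (distr \<Omega> borel X) {e..}"
    by (subst measure_distr) (auto intro!: arg_cong[where f=prob])
  also have "\<dots> = measure M {\<omega>\<in>space M. e \<le> V \<omega>}"
    unfolding X(2) using V by (subst measure_distr) (auto intro!: arg_cong[where f="measure M"])
  finally have "1 \<le> ereal (real n) * \<rho> (indicator ?A)"
    using tail by (intro rho_indicator_ge[OF n A]) simp
  then have "ereal (e / real n) * 1 \<le> ereal (e / real n) * (ereal (real n) * \<rho> (indicator ?A))"
    using e by (intro ereal_mult_left_mono) auto
  also have "\<dots> = ereal e * \<rho> (indicator ?A)"
    using n by (simp add: mult.assoc[symmetric])
  also have "\<dots> = \<rho> (\<lambda>\<omega>. e * indicator ?A \<omega>)"
    by (rule positive_homogeneity[OF indicator_rv[OF A] e, symmetric])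
  also have "\<dots> \<le> \<rho> X"
    using X(1) e A by (intro monotonicity) (auto simp: nonneg_rvs_def indicator_def)
  finally show ?thesis using X(3) by simp
qed

end
section \<open>Gluing two probability spaces along a discrete label\<close>

lemma nn_integral_glue_density:
  assumes B: "prob_space B" and l[measurable]: "l \<in> B \<rightarrow>\<^sub>M count_space (UNIV :: nat set)"
    and n: "measure B {y\<in>space B. l y = n} \<noteq> 0"
  shows "(\<integral>\<^sup>+y. (if n = l y then ennreal (1 / measure B {y\<in>space B. l y = n}) else 0) \<partial>B) = 1"
proof -
  interpret prob_space B by (rule B)
  let ?p = "measure B {y\<in>space B. l y = n}"
  have "(\<integral>\<^sup>+y. (if n = l y then ennreal (1 / ?p) else 0) \<partial>B)
      = (\<integral>\<^sup>+y. ennreal (1 / ?p) * indicator {y\<in>space B. l y = n} y \<partial>B)"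
    by (intro nn_integral_cong) (auto simp: indicator_def)
  also have "\<dots> = ennreal (1 / ?p) * emeasure B {y\<in>space B. l y = n}"
    by (rule nn_integral_cmult_indicator) measurable
  also have "\<dots> = ennreal (1 / ?p * ?p)"
    by (simp add: emeasure_eq_measure ennreal_mult[symmetric] del: times_divide_eq_left)
  finally show ?thesis using n by simp
qed

lemma AE_label_not_null:
  assumes A: "prob_space A" and k[measurable]: "k \<in> A \<rightarrow>\<^sub>M count_space (UNIV :: nat set)"
  shows "AE x in A. measure A {y\<in>space A. k y = k x} \<noteq> 0"
proof -
  interpret prob_space A by (rule A)
  have "AE x in A. measure A {y\<in>space A. k y = n} = 0 \<longrightarrow> k x \<noteq> n" for n
  proof (cases "measure A {y\<in>space A. k y = n} = 0")
    case True
    then show ?thesis using prob_Collect_eq_0[of "\<lambda>y. k y = n"] by simp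
  qed simp
  then have "AE x in A. \<forall>n. measure A {y\<in>space A. k y = n} = 0 \<longrightarrow> k x \<noteq> n"
    by (simp add: AE_all_countable)
  then show ?thesis by eventually_elim blast
qed

text \<open>The glued measure draws a label with its common law and then a point of \<open>A\<close> and a point of
  \<open>B\<close> independently, conditionally on the label. As conditioning on the values of a discrete
  variable is elementary, it has an explicit density with respect to the product measure.\<close>

lemma glue_along_label:
  assumes A: "prob_space A" and B: "prob_space B"
    and k[measurable]: "k \<in> A \<rightarrow>\<^sub>M count_space (UNIV :: nat set)"
    and l[measurable]: "l \<in> B \<rightarrow>\<^sub>M count_space (UNIV :: nat set)"
    and eq: "distr A (count_space UNIV) k = distr B (count_space UNIV) l"
  obtains M where "prob_space M" "sets M = sets (A \<Otimes>\<^sub>M B)" "distr M A fst = A" "distr M B snd = B"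
    "AE z in M. k (fst z) = l (snd z)"
proof -
  interpret A: prob_space A by (rule A)
  interpret B: prob_space B by (rule B)
  interpret AB: pair_prob_space A B ..
  define p where "p n = measure A {x\<in>space A. k x = n}" for n
  have pB: "p n = measure B {y\<in>space B. l y = n}" for n
  proof -
    have "p n = measure (distr A (count_space UNIV) k) {n}"
      unfolding p_def by (subst measure_distr) (auto intro!: arg_cong[where f="measure A"])
    also have "\<dots> = measure B {y\<in>space B. l y = n}"
      unfolding eq by (subst measure_distr) (auto intro!: arg_cong[where f="measure B"])
    finally show ?thesis .
  qed
  define h where "h z = (if k (fst z) = l (snd z) then ennreal (1 / p (k (fst z))) else 0)" for z
  have label[measurable]: "(\<lambda>z. k (fst z)) \<in> A \<Otimes>\<^sub>M B \<rightarrow>\<^sub>M count_space UNIV"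
    "(\<lambda>z. l (snd z)) \<in> A \<Otimes>\<^sub>M B \<rightarrow>\<^sub>M count_space UNIV"
    by measurable
  have weight: "(\<lambda>z. ennreal (1 / p (k (fst z)))) \<in> borel_measurable (A \<Otimes>\<^sub>M B)"
    by (rule measurable_compose[OF label(1)]) simp
  have h[measurable]: "h \<in> borel_measurable (A \<Otimes>\<^sub>M B)"
    unfolding h_def
  proof (rule measurable_If[OF weight])
    have "{z\<in>space (A \<Otimes>\<^sub>M B). \<exists>n. k (fst z) = n \<and> l (snd z) = n} \<in> sets (A \<Otimes>\<^sub>M B)"
      by measurable
    then show "{z\<in>space (A \<Otimes>\<^sub>M B). k (fst z) = l (snd z)} \<in> sets (A \<Otimes>\<^sub>M B)"
      by (rule back_subst[where P = "\<lambda>S. S \<in> sets (A \<Otimes>\<^sub>M B)"]) auto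
  qed simp
  define M where "M = density (A \<Otimes>\<^sub>M B) h"
  have sets_M[measurable_cong]: "sets M = sets (A \<Otimes>\<^sub>M B)" by (simp add: M_def)
  have space_M: "space M = space A \<times> space B" by (simp add: M_def space_pair_measure)
  have inner_B: "AE x in A. (\<integral>\<^sup>+y. h (x, y) \<partial>B) = 1"
    using AE_label_not_null[OF A k]
  proof eventually_elim
    case (elim x)
    have "(\<integral>\<^sup>+y. h (x, y) \<partial>B) = (\<integral>\<^sup>+y. (if k x = l y then ennreal (1 / p (k x)) else 0) \<partial>B)"
      by (simp only: h_def fst_conv snd_conv)
    also have "\<dots> = 1"
      using elim unfolding p_def[symmetric] unfolding pB by (rule nn_integral_glue_density[OF B l])
    finally show ?case .
  qed
  have inner_A: "AE y in B. (\<integral>\<^sup>+x. h (x, y) \<partial>A) = 1"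
    using AE_label_not_null[OF B l]
  proof eventually_elim
    case (elim y)
    have "(\<integral>\<^sup>+x. h (x, y) \<partial>A) = (\<integral>\<^sup>+x. (if l y = k x then ennreal (1 / p (l y)) else 0) \<partial>A)"
      by (intro nn_integral_cong) (auto simp: h_def)
    also have "\<dots> = 1"
      using elim unfolding pB[symmetric] unfolding p_def by (rule nn_integral_glue_density[OF A k])
    finally show ?case .
  qed
  have fst_M: "distr M A fst = A"
  proof (rule measure_eqI)
    fix S assume "S \<in> sets (distr M A fst)"
    then have S[measurable]: "S \<in> sets A" by simp
    have "emeasure (distr M A fst) S = emeasure M (S \<times> space B)"
      using sets.sets_into_space[OF S]
      by (subst emeasure_distr) (auto simp: space_M intro!: arg_cong[where f="emeasure M"])
    also have "\<dots> = (\<integral>\<^sup>+z. h z * indicator (S \<times> space B) z \<partial>(A \<Otimes>\<^sub>M B))"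
      unfolding M_def by (rule emeasure_density) auto
    also have "\<dots> = (\<integral>\<^sup>+x. \<integral>\<^sup>+y. h (x, y) * indicator (S \<times> space B) (x, y) \<partial>B \<partial>A)"
      by (subst B.nn_integral_fst) auto
    also have "\<dots> = (\<integral>\<^sup>+x. \<integral>\<^sup>+y. h (x, y) * indicator S x \<partial>B \<partial>A)"
      by (intro nn_integral_cong) (auto simp: indicator_def)
    also have "\<dots> = (\<integral>\<^sup>+x. (\<integral>\<^sup>+y. h (x, y) \<partial>B) * indicator S x \<partial>A)"
      by (intro nn_integral_cong nn_integral_multc) measurable
    also have "\<dots> = (\<integral>\<^sup>+x. indicator S x \<partial>A)"
      using inner_B by (intro nn_integral_cong_AE) (auto elim: eventually_mono)
    finally show "emeasure (distr M A fst) S = emeasure A S" by simp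
  qed simp
  have snd_M: "distr M B snd = B"
  proof (rule measure_eqI)
    fix S assume "S \<in> sets (distr M B snd)"
    then have S[measurable]: "S \<in> sets B" by simp
    have "emeasure (distr M B snd) S = emeasure M (space A \<times> S)"
      using sets.sets_into_space[OF S]
      by (subst emeasure_distr) (auto simp: space_M intro!: arg_cong[where f="emeasure M"])
    also have "\<dots> = (\<integral>\<^sup>+z. h z * indicator (space A \<times> S) z \<partial>(A \<Otimes>\<^sub>M B))"
      unfolding M_def by (rule emeasure_density) auto
    also have "\<dots> = (\<integral>\<^sup>+y. \<integral>\<^sup>+x. h (x, y) * indicator (space A \<times> S) (x, y) \<partial>A \<partial>B)"
      by (subst AB.nn_integral_snd) auto
    also have "\<dots> = (\<integral>\<^sup>+y. \<integral>\<^sup>+x. h (x, y) * indicator S y \<partial>A \<partial>B)"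
      by (intro nn_integral_cong) (auto simp: indicator_def)
    also have "\<dots> = (\<integral>\<^sup>+y. (\<integral>\<^sup>+x. h (x, y) \<partial>A) * indicator S y \<partial>B)"
      by (intro nn_integral_cong nn_integral_multc) measurable
    also have "\<dots> = (\<integral>\<^sup>+y. indicator S y \<partial>B)"
      using inner_A by (intro nn_integral_cong_AE) (auto elim: eventually_mono)
    finally show "emeasure (distr M B snd) S = emeasure B S" by simp
  qed simp
  have "prob_space M"
  proof (rule prob_space_distrD)
    show "fst \<in> M \<rightarrow>\<^sub>M A" by measurable
    show "prob_space (distr M A fst)" unfolding fst_M by (rule A)
  qed
  moreover have "AE z in M. k (fst z) = l (snd z)"
    unfolding M_def AE_density[OF h] by (auto simp: h_def)
  ultimately show ?thesis using sets_M fst_M snd_M by (intro that)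
qed

section \<open>Norms on Euclidean spaces\<close>

lemma
  assumes N: "is_norm N"
  shows is_norm_nonneg: "0 \<le> N x" and is_norm_triangle: "N (x + y) \<le> N x + N y"
    and is_norm_zero: "N 0 = 0" and is_norm_minus_commute: "N (x - y) = N (y - x)"
proof -
  have "N ((-1) *\<^sub>R (y - x)) = \<bar>-1\<bar> * N (y - x)" using N unfolding is_norm_def by blast
  then show "N (x - y) = N (y - x)" by simp
qed (use N in \<open>auto simp: is_norm_def\<close>)

lemma is_norm_continuous:
  fixes N :: "'a::euclidean_space \<Rightarrow> real"
  assumes "is_norm N"
  shows "continuous_on UNIV N"
proof (rule convex_on_continuous)
  show "convex_on UNIV N"
  proof (rule convex_onI)
    fix t :: real and x y :: 'a assume "0 < t" "t < 1"
    have "N ((1 - t) *\<^sub>R x + t *\<^sub>R y) \<le> N ((1 - t) *\<^sub>R x) + N (t *\<^sub>R y)"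
      using assms unfolding is_norm_def by blast
    also have "\<dots> = (1 - t) * N x + t * N y"
      using assms \<open>0 < t\<close> \<open>t < 1\<close> unfolding is_norm_def by simp
    finally show "N ((1 - t) *\<^sub>R x + t *\<^sub>R y) \<le> (1 - t) * N x + t * N y" .
  qed simp
qed simp

lemma is_norm_lower_bound:
  fixes N :: "'a::euclidean_space \<Rightarrow> real"
  assumes N: "is_norm N"
  obtains m where "0 < m" "\<And>x. m * norm x \<le> N x"
proof -
  have "continuous_on (sphere 0 1) N"
    using is_norm_continuous[OF N] continuous_on_subset by blast
  then obtain x0 :: 'a where x0: "x0 \<in> sphere 0 1" "\<And>x. x \<in> sphere 0 1 \<Longrightarrow> N x0 \<le> N x"
    using continuous_attains_inf[of "sphere (0::'a) 1" N] compact_sphere[of "0::'a" 1] by auto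
  have "0 < N x0"
    using N x0(1) unfolding is_norm_def by (metis less_eq_real_def mem_sphere_0 norm_zero zero_neq_one)
  moreover have "N x0 * norm x \<le> N x" for x
  proof (cases "x = 0")
    case True
    then show ?thesis using N unfolding is_norm_def by simp
  next
    case False
    have "N x0 \<le> N ((1 / norm x) *\<^sub>R x)" using False by (intro x0(2)) simp
    also have "\<dots> = N x / norm x" using N unfolding is_norm_def by simp
    finally show ?thesis using False by (simp add: field_simps)
  qed
  ultimately show ?thesis by (rule that)
qed

text \<open>The label \<open>c x\<close> is the index of the first point of a countable dense set that is closer than
  \<open>e / 2\<close> to \<open>x\<close>.\<close>

lemma is_norm_cells:
  fixes N :: "'a::euclidean_space \<Rightarrow> real"
  assumes N: "is_norm N" and e: "0 < e"
  obtains c where "c \<in> borel \<rightarrow>\<^sub>M count_space (UNIV :: nat set)"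
    and "\<And>x y. c x = c y \<Longrightarrow> N (x - y) \<le> e"
proof -
  obtain D :: "'a set" where D: "countable D" "\<And>X. open X \<Longrightarrow> X \<noteq> {} \<Longrightarrow> \<exists>d\<in>D. d \<in> X"
    using countable_dense_setE by blast
  have "D \<noteq> {}" using D(2)[of UNIV] by auto
  define d where "d = from_nat_into D"
  define c where "c x = (LEAST n. N (x - d n) < e / 2)" for x
  have [measurable]: "N \<in> borel_measurable borel"
    using is_norm_continuous[OF N] by (rule borel_measurable_continuous_onI)
  have ex: "\<exists>n. N (x - d n) < e / 2" for x
  proof -
    have "open ((\<lambda>y. N (x - y)) -` {..<e / 2})"
      by (intro open_vimage continuous_on_compose2[OF is_norm_continuous[OF N]] continuous_intros) auto
    moreover have "x \<in> (\<lambda>y. N (x - y)) -` {..<e / 2}"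
      using is_norm_zero[OF N] e by simp
    ultimately obtain y where "y \<in> D" "N (x - y) < e / 2" using D(2) by blast
    then show ?thesis
      unfolding d_def using from_nat_into_surj[OF D(1)] by metis
  qed
  have near: "N (x - d (c x)) < e / 2" for x
    unfolding c_def by (rule LeastI_ex[OF ex])
  show ?thesis
  proof (rule that[of c])
    show "c \<in> borel \<rightarrow>\<^sub>M count_space UNIV" unfolding c_def by measurable
    fix x y assume "c x = c y"
    have "N (x - y) \<le> N (x - d (c x)) + N (d (c x) - y)"
      using is_norm_triangle[OF N, of "x - d (c x)" "d (c x) - y"] by simp
    also have "N (d (c x) - y) = N (y - d (c y))"
      unfolding \<open>c x = c y\<close> by (rule is_norm_minus_commute[OF N])
    finally show "N (x - y) \<le> e" using near[of x] near[of y] by simp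
  qed
qed

section \<open>The coherent Wasserstein distance\<close>

context law_invariant_coherent_risk_measure
begin

lemma risk_distr:
  assumes "f \<in> M \<rightarrow>\<^sub>M M'" and "g \<in> borel_measurable M'"
  shows "risk (distr M M' f) g = risk M (\<lambda>x. g (f x))"
  unfolding risk_def using assms by (subst distr_distr) (auto simp: comp_def)

lemma coherent_wasserstein_eq:
  "coherent_wasserstein \<Omega> \<rho> N P1 P2 = (INF Q\<in>couplings P1 P2. risk Q (\<lambda>z. N (fst z - snd z)))"
  by (simp add: coherent_wasserstein_def risk_def case_prod_beta')

context
  fixes N :: "'a::euclidean_space \<Rightarrow> real"
  assumes N: "is_norm N"
begin

lemma N_measurable[measurable]: "N \<in> borel_measurable borel"
  using is_norm_continuous[OF N] by (rule borel_measurable_continuous_onI)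

lemmas N_nonneg = is_norm_nonneg[OF N] and N_triangle = is_norm_triangle[OF N]
  and N_zero = is_norm_zero[OF N] and N_minus = is_norm_minus_commute[OF N]

lemma cost_measurable:
  "Q \<in> couplings P1 P2 \<Longrightarrow> (\<lambda>z. N (fst z - snd z)) \<in> borel_measurable Q"
  unfolding couplings_def by (auto cong: measurable_cong_sets)

lemma cost_nonneg:
  "Q \<in> couplings P1 P2 \<Longrightarrow> 0 \<le> risk Q (\<lambda>z. N (fst z - snd z))"
  by (intro risk_nonneg cost_measurable) (auto simp: couplings_def N_nonneg)

lemma wasserstein_nonneg: "0 \<le> coherent_wasserstein \<Omega> \<rho> N P1 P2"
  unfolding coherent_wasserstein_eq by (intro INF_greatest cost_nonneg)

lemma wasserstein_self:
  assumes P: "prob_space P" and [measurable_cong]: "sets P = sets borel"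
  shows "coherent_wasserstein \<Omega> \<rho> N P P = 0"
proof (rule antisym[OF _ wasserstein_nonneg])
  interpret P: prob_space P by (rule P)
  let ?Q = "distr P (borel \<Otimes>\<^sub>M borel) (\<lambda>x. (x, x))"
  have "distr ?Q borel fst = P" "distr ?Q borel snd = P"
    using assms(2) by (auto simp: distr_distr comp_def intro!: distr_id2)
  moreover have "prob_space ?Q" by (intro P.prob_space_distr) measurable
  ultimately have Q: "?Q \<in> couplings P P" by (simp add: couplings_def)
  have "risk ?Q (\<lambda>z. N (fst z - snd z)) = risk P (\<lambda>x. 0)"
    by (subst risk_distr) (auto simp: N_zero)
  also have "\<dots> = \<rho> (\<lambda>_. 0)"
    by (intro risk_eqI) (auto simp: nonneg_rvs_def)
  finally have "risk ?Q (\<lambda>z. N (fst z - snd z)) \<le> 0" using zero by simp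
  then show "coherent_wasserstein \<Omega> \<rho> N P P \<le> 0"
    unfolding coherent_wasserstein_eq by (rule INF_lower2[OF Q])
qed

lemma wasserstein_commute_le:
  "coherent_wasserstein \<Omega> \<rho> N P2 P1 \<le> coherent_wasserstein \<Omega> \<rho> N P1 P2"
  unfolding coherent_wasserstein_eq
proof (rule INF_mono)
  fix Q assume Q: "Q \<in> couplings P1 P2"
  interpret Q: prob_space Q using Q by (simp add: couplings_def)
  have [measurable_cong]: "sets Q = sets (borel \<Otimes>\<^sub>M borel)" using Q by (simp add: couplings_def)
  let ?Q = "distr Q (borel \<Otimes>\<^sub>M borel) (\<lambda>z. (snd z, fst z))"
  have "distr ?Q borel fst = P2" "distr ?Q borel snd = P1"
    using Q by (auto simp: distr_distr comp_def couplings_def)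
  moreover have "prob_space ?Q" by (intro Q.prob_space_distr) measurable
  ultimately have Q': "?Q \<in> couplings P2 P1" by (simp add: couplings_def)
  have "risk ?Q (\<lambda>z. N (fst z - snd z)) = risk Q (\<lambda>z. N (fst z - snd z))"
    by (subst risk_distr) (auto simp: N_minus)
  then show "\<exists>Q'\<in>couplings P2 P1. risk Q' (\<lambda>z. N (fst z - snd z)) \<le> risk Q (\<lambda>z. N (fst z - snd z))"
    by (intro bexI[OF _ Q']) simp
qed

lemma wasserstein_commute:
  "coherent_wasserstein \<Omega> \<rho> N P1 P2 = coherent_wasserstein \<Omega> \<rho> N P2 P1"
  by (intro antisym wasserstein_commute_le)

text \<open>Under the measure \<open>M\<close> glued along the cell of the middle point, the points \<open>((x1, x2), (y2, y3))\<close>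
  have \<open>x2\<close> and \<open>y2\<close> in the same cell. The law of \<open>(x1, y3)\<close> is the required coupling, since
  \<open>N (x1 - y3) \<le> N (x1 - x2) + e + N (y2 - y3)\<close>.\<close>

lemma approximate_composition:
  assumes Q12: "Q12 \<in> couplings P1 P2" and Q23: "Q23 \<in> couplings P2 P3" and e: "0 < e"
  obtains Q13 where "Q13 \<in> couplings P1 P3"
    "risk Q13 (\<lambda>z. N (fst z - snd z)) \<le>
      risk Q12 (\<lambda>z. N (fst z - snd z)) + risk Q23 (\<lambda>z. N (fst z - snd z)) + ereal e"
proof -
  have sets_Q[measurable_cong]: "sets Q12 = sets (borel \<Otimes>\<^sub>M borel)" "sets Q23 = sets (borel \<Otimes>\<^sub>M borel)"
    using Q12 Q23 by (auto simp: couplings_def)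
  obtain c :: "'a \<Rightarrow> nat" where c[measurable]: "c \<in> borel \<rightarrow>\<^sub>M count_space UNIV"
    and cell: "\<And>x y. c x = c y \<Longrightarrow> N (x - y) \<le> e"
    using is_norm_cells[OF N e] by blast
  have "distr Q12 (count_space UNIV) (\<lambda>z. c (snd z)) = distr (distr Q12 borel snd) (count_space UNIV) c"
    by (subst distr_distr) (auto simp: comp_def)
  also have "\<dots> = distr (distr Q23 borel fst) (count_space UNIV) c"
    using Q12 Q23 by (simp add: couplings_def)
  also have "\<dots> = distr Q23 (count_space UNIV) (\<lambda>z. c (fst z))"
    by (subst distr_distr) (auto simp: comp_def)
  finally have same_law: "distr Q12 (count_space UNIV) (\<lambda>z. c (snd z))
      = distr Q23 (count_space UNIV) (\<lambda>z. c (fst z))" .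
  have Q: "prob_space Q12" "prob_space Q23" using Q12 Q23 by (simp_all add: couplings_def)
  have labels: "(\<lambda>z. c (snd z)) \<in> Q12 \<rightarrow>\<^sub>M count_space UNIV" "(\<lambda>z. c (fst z)) \<in> Q23 \<rightarrow>\<^sub>M count_space UNIV"
    by measurable
  obtain M where M: "prob_space M" and sets_M: "sets M = sets (Q12 \<Otimes>\<^sub>M Q23)"
    and M12: "distr M Q12 fst = Q12" and M23: "distr M Q23 snd = Q23"
    and same_cell: "AE z in M. c (snd (fst z)) = c (fst (snd z))"
    using glue_along_label[OF Q labels same_law] .
  interpret M: prob_space M by (rule M)
  note [measurable_cong] = sets_M
  have [measurable]: "fst \<in> M \<rightarrow>\<^sub>M Q12" "snd \<in> M \<rightarrow>\<^sub>M Q23" by measurable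
  let ?Q13 = "distr M (borel \<Otimes>\<^sub>M borel) (\<lambda>z. (fst (fst z), snd (snd z)))"
  have "distr ?Q13 borel fst = distr (distr M Q12 fst) borel fst"
    by (simp add: distr_distr comp_def)
  moreover have "distr ?Q13 borel snd = distr (distr M Q23 snd) borel snd"
    by (simp add: distr_distr comp_def)
  moreover have "prob_space ?Q13" by (intro M.prob_space_distr) measurable
  ultimately have Q13: "?Q13 \<in> couplings P1 P3"
    using Q12 Q23 unfolding M12 M23 by (simp add: couplings_def)
  let ?V = "\<lambda>z. N (fst (fst z) - snd (fst z))" and ?W = "\<lambda>z. N (fst (snd z) - snd (snd z))"
  have "risk ?Q13 (\<lambda>z. N (fst z - snd z)) = risk M (\<lambda>z. N (fst (fst z) - snd (snd z)))"
    by (subst risk_distr) auto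
  also have "\<dots> \<le> risk M (\<lambda>z. ?V z + ?W z + e)"
  proof (rule risk_mono[OF M])
    show "AE z in M. N (fst (fst z) - snd (snd z)) \<le> ?V z + ?W z + e"
      using same_cell
    proof eventually_elim
      case (elim z)
      obtain x1 x2 y2 y3 where z: "z = ((x1, x2), (y2, y3))" by (metis prod.collapse)
      have "N (x1 - y3) \<le> N (x1 - x2) + N ((x2 - y2) + (y2 - y3))"
        using N_triangle[of "x1 - x2" "(x2 - y2) + (y2 - y3)"] by simp
      also have "N ((x2 - y2) + (y2 - y3)) \<le> N (x2 - y2) + N (y2 - y3)" by (rule N_triangle)
      finally show ?case using cell[of x2 y2] elim by (simp add: z)
    qed
  qed (auto simp: N_nonneg)
  also have "\<dots> = risk M (\<lambda>z. ?V z + ?W z) + ereal e"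
    using e by (intro risk_add_const[OF M]) (auto simp: N_nonneg)
  also have "risk M (\<lambda>z. ?V z + ?W z) \<le> risk M ?V + risk M ?W"
    by (intro risk_subadditive[OF M]) (auto simp: N_nonneg)
  also have "risk M ?V = risk (distr M Q12 fst) (\<lambda>z. N (fst z - snd z))"
    by (subst risk_distr) auto
  also have "risk M ?W = risk (distr M Q23 snd) (\<lambda>z. N (fst z - snd z))"
    by (subst risk_distr) auto
  finally show ?thesis
    using Q13 unfolding M12 M23 by (intro that) (auto intro: add_right_mono)
qed

lemma wasserstein_triangle:
  "coherent_wasserstein \<Omega> \<rho> N P1 P3 \<le>
    coherent_wasserstein \<Omega> \<rho> N P1 P2 + coherent_wasserstein \<Omega> \<rho> N P2 P3"
proof -
  let ?r = "\<lambda>Q. risk Q (\<lambda>z. N (fst z - snd z))" and ?d = "coherent_wasserstein \<Omega> \<rho> N"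
  have couple: "?d P1 P3 \<le> ?r Q12 + ?r Q23" 
    if Q: "Q12 \<in> couplings P1 P2" "Q23 \<in> couplings P2 P3" for Q12 Q23
  proof (rule ereal_le_epsilon2)
    fix e :: real assume "0 < e"
    obtain Q13 where "Q13 \<in> couplings P1 P3" "?r Q13 \<le> ?r Q12 + ?r Q23 + ereal e"
      using approximate_composition[OF Q \<open>0 < e\<close>] by blast
    then show "?d P1 P3 \<le> ?r Q12 + ?r Q23 + ereal e"
      unfolding coherent_wasserstein_eq by (rule INF_lower2)
  qed
  show ?thesis
  proof (cases "?d P1 P2 = \<infinity> \<or> ?d P2 P3 = \<infinity>")
    case True
    then show ?thesis using wasserstein_nonneg[of P1 P2] wasserstein_nonneg[of P2 P3] by auto
  next
    case False
    show ?thesis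
    proof (rule ereal_le_epsilon2)
      fix e :: real assume "0 < e"
      have near: "\<exists>Q\<in>couplings P P'. ?r Q < ?d P P' + ereal (e / 2)" if "?d P P' \<noteq> \<infinity>" for P P'
      proof -
        have "?d P P' < ?d P P' + ereal (e / 2)"
          using that wasserstein_nonneg[of P P'] \<open>0 < e\<close> by (cases "?d P P'") auto
        then show ?thesis unfolding coherent_wasserstein_eq[of N P P'] INF_less_iff .
      qed
      obtain Q12 Q23 where Q: "Q12 \<in> couplings P1 P2" "?r Q12 < ?d P1 P2 + ereal (e / 2)"
        "Q23 \<in> couplings P2 P3" "?r Q23 < ?d P2 P3 + ereal (e / 2)"
        using near[of P1 P2] near[of P2 P3] False by blast
      have "?d P1 P3 \<le> ?r Q12 + ?r Q23" by (rule couple[OF Q(1,3)])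
      also have "\<dots> \<le> (?d P1 P2 + ereal (e / 2)) + (?d P2 P3 + ereal (e / 2))"
        using Q by (intro add_mono less_imp_le)
      also have "\<dots> = ?d P1 P2 + ?d P2 P3 + (ereal (e / 2) + ereal (e / 2))"
        by (simp only: ac_simps)
      also have "ereal (e / 2) + ereal (e / 2) = ereal e" by simp
      finally show "?d P1 P3 \<le> ?d P1 P2 + ?d P2 P3 + ereal e" .
    qed
  qed
qed

lemma wasserstein_zero_coupling_close:
  assumes d: "coherent_wasserstein \<Omega> \<rho> N P1 P2 = 0" and e: "0 < e" and n: "0 < n"
  obtains Q where "Q \<in> couplings P1 P2" "measure Q {z\<in>space Q. e \<le> N (fst z - snd z)} < 1 / real n"
proof -
  have "coherent_wasserstein \<Omega> \<rho> N P1 P2 < ereal (e / real n)" using d e n by simp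
  then obtain Q where Q: "Q \<in> couplings P1 P2" "risk Q (\<lambda>z. N (fst z - snd z)) < ereal (e / real n)"
    unfolding coherent_wasserstein_eq INF_less_iff by blast
  have "prob_space Q" using Q by (simp add: couplings_def)
  then have "measure Q {z\<in>space Q. e \<le> N (fst z - snd z)} < 1 / real n"
    using risk_ge_of_tail[OF _ cost_measurable[OF Q(1)] _ n e] Q(2) N_nonneg
    by (meson AE_I2 leD not_le_imp_less)
  with Q(1) show ?thesis by (rule that)
qed

text \<open>A coupling that keeps the two components close moves the mass of \<open>F\<close> into the closed
  neighbourhood \<open>G i\<close> of \<open>F\<close>, up to a small probability. These neighbourhoods decrease to \<open>F\<close>
  because \<open>F\<close> is closed.\<close>

lemma wasserstein_zero_closed_le:
  assumes d: "coherent_wasserstein \<Omega> \<rho> N P1 P2 = 0" and P2: "prob_space P2" "sets P2 = sets borel"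
    and F: "closed F"
  shows "measure P1 F \<le> measure P2 F"
proof (cases "F = {}")
  case False
  interpret P2: prob_space P2 by (rule P2)
  obtain m where m: "0 < m" "\<And>x. m * norm x \<le> N x" using is_norm_lower_bound[OF N] by blast
  define G where "G i = {y. infdist y F \<le> 1 / real (Suc i)}" for i
  have G_closed: "closed (G i)" for i
    unfolding G_def by (intro closed_Collect_le continuous_intros)
  have le_G: "measure P1 F \<le> measure P2 (G i)" for i
  proof (rule field_le_epsilon)
    fix \<delta> :: real assume "0 < \<delta>"
    then obtain n where n: "1 / real (Suc n) < \<delta>" by (rule nat_approx_posE)
    obtain Q where Q: "Q \<in> couplings P1 P2"
      and far: "measure Q {z\<in>space Q. m / real (Suc i) \<le> N (fst z - snd z)} < 1 / real (Suc n)"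
      using wasserstein_zero_coupling_close[OF d, of "m / real (Suc i)" "Suc n"] m(1) by auto
    interpret Q: prob_space Q using Q by (simp add: couplings_def)
    have [measurable_cong]: "sets Q = sets (borel \<Otimes>\<^sub>M borel)" using Q by (simp add: couplings_def)
    have space_Q: "space Q = UNIV"
      using Q sets_eq_imp_space_eq[of Q "borel \<Otimes>\<^sub>M borel"] by (simp add: couplings_def space_pair_measure)
    have P: "P1 = distr Q borel fst" "P2 = distr Q borel snd" using Q by (auto simp: couplings_def)
    have [measurable]: "F \<in> sets borel" "G i \<in> sets borel" using F G_closed by auto
    have near: "N (x - y) \<ge> m / real (Suc i)" if "x \<in> F" "y \<notin> G i" for x y
    proof -
      have "1 / real (Suc i) < infdist y F" using that(2) by (simp add: G_def)
      also have "\<dots> \<le> dist y x" using that(1) by (rule infdist_le)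
      finally have "m * (1 / real (Suc i)) \<le> m * norm (x - y)"
        using m(1) by (intro mult_left_mono) (auto simp: dist_norm norm_minus_commute)
      also have "\<dots> \<le> N (x - y)" by (rule m(2))
      finally show ?thesis by simp
    qed
    have "measure P1 F = measure Q {z\<in>space Q. fst z \<in> F}"
      unfolding P(1) by (subst measure_distr) (auto intro!: arg_cong[where f="measure Q"])
    also have "\<dots> \<le> measure Q ({z\<in>space Q. snd z \<in> G i} \<union> {z\<in>space Q. m / real (Suc i) \<le> N (fst z - snd z)})"
      using near by (intro Q.finite_measure_mono) auto
    also have "\<dots> \<le> measure Q {z\<in>space Q. snd z \<in> G i} + measure Q {z\<in>space Q. m / real (Suc i) \<le> N (fst z - snd z)}"
      by (intro measure_Un_le) measurable
    also have "measure Q {z\<in>space Q. snd z \<in> G i} = measure P2 (G i)"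
      unfolding P(2) by (subst measure_distr) (auto intro!: arg_cong[where f="measure Q"])
    finally show "measure P1 F \<le> measure P2 (G i) + \<delta>" using far n by simp
  qed
  have "(\<lambda>i. measure P2 (G i)) \<longlonglongrightarrow> measure P2 (\<Inter>i. G i)"
  proof (rule P2.finite_Lim_measure_decseq)
    show "range G \<subseteq> sets P2" using P2(2) G_closed by auto
    show "decseq G"
      unfolding decseq_def G_def by (auto intro: order_trans simp: frac_le elim!: order_trans)
  qed
  moreover have "(\<Inter>i. G i) = F"
  proof (intro equalityI subsetI)
    fix y assume y: "y \<in> (\<Inter>i. G i)"
    have "infdist y F \<le> 0"
    proof (rule field_le_epsilon)
      fix \<delta> :: real assume "0 < \<delta>"
      then obtain n where "1 / real (Suc n) < \<delta>" by (rule nat_approx_posE)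
      moreover have "infdist y F \<le> 1 / real (Suc n)" using y by (auto simp: G_def)
      ultimately show "infdist y F \<le> 0 + \<delta>" by simp
    qed
    then show "y \<in> F"
      using in_closed_iff_infdist_zero[OF F False] infdist_nonneg[of y F] by (metis antisym)
  qed (auto simp: G_def)
  ultimately show ?thesis using le_G by (auto intro: LIMSEQ_le_const)
qed simp

lemma wasserstein_zero_imp_eq:
  assumes d: "coherent_wasserstein \<Omega> \<rho> N P1 P2 = 0"
    and P1: "prob_space P1" "sets P1 = sets borel" and P2: "prob_space P2" "sets P2 = sets borel"
  shows "P1 = P2"
proof (rule measure_eqI_generator_eq[where E = "Collect closed" and \<Omega> = UNIV and A = "\<lambda>_. UNIV"])
  interpret P1: prob_space P1 by (rule P1)
  interpret P2: prob_space P2 by (rule P2)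
  have d': "coherent_wasserstein \<Omega> \<rho> N P2 P1 = 0" using d wasserstein_commute by simp
  show "emeasure P1 X = emeasure P2 X" if "X \<in> Collect closed" for X
    using wasserstein_zero_closed_le[OF d P2, of X] wasserstein_zero_closed_le[OF d' P1, of X] that
    by (simp add: P1.emeasure_eq_measure P2.emeasure_eq_measure)
  show "emeasure P1 UNIV \<noteq> \<infinity>" by simp
  show "sets P1 = sigma_sets UNIV (Collect closed)" "sets P2 = sigma_sets UNIV (Collect closed)"
    using P1(2) P2(2) by (simp_all add: borel_eq_closed)
qed (auto simp: Int_stable_def)

end
end

theorem proposition2:
  fixes \<Omega> :: "'w measure" and \<rho> :: "('w \<Rightarrow> real) \<Rightarrow> ereal"
    and N :: "real ^ 'm \<Rightarrow> real" and \<Xi> :: "(real ^ 'm) set"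
  assumes "law_invariant_coherent_risk_measure \<Omega> \<rho>"
    and "is_norm N"
    and "convex \<Xi>"
  shows "let d = coherent_wasserstein \<Omega> \<rho> N in
    (\<forall>P1\<in>distributions_on \<Xi>. \<forall>P2\<in>distributions_on \<Xi>. d P1 P2 = 0 \<longleftrightarrow> P1 = P2) \<and>
    (\<forall>P1\<in>distributions_on \<Xi>. \<forall>P2\<in>distributions_on \<Xi>. d P1 P2 = d P2 P1) \<and>
    (\<forall>P1\<in>distributions_on \<Xi>. \<forall>P2\<in>distributions_on \<Xi>. \<forall>P3\<in>distributions_on \<Xi>.
       d P1 P2 + d P2 P3 \<ge> d P1 P3) \<and>
    (\<forall>P1\<in>distributions_on \<Xi>. \<forall>P2\<in>distributions_on \<Xi>. d P1 P2 \<ge> 0)"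
proof -
  interpret law_invariant_coherent_risk_measure \<Omega> \<rho> by (rule assms(1))
  note N = \<open>is_norm N\<close>
  have P: "prob_space P" "sets P = sets borel" if "P \<in> distributions_on \<Xi>" for P
    using that by (auto simp: distributions_on_def)
  show ?thesis
    unfolding Let_def
    using wasserstein_zero_imp_eq[OF N] wasserstein_self[OF N] P
    by (auto intro: wasserstein_commute[OF N] wasserstein_triangle[OF N] wasserstein_nonneg[OF N])
qed

end
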